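(* Let $n\geq1$ and $p,q>1$ satisfy \[ \frac{p+1}{pq-1}>\frac{n-1}{2},\qquad \frac{n-1}{2}(q-1)<1 . \] Consider the system \[ \partial_t^2u-\Delta u=|v|^q,\qquad \partial_t^2v-\Delta v=|\partial_t u|^p,\qquad (t,x)\in[0,\infty)\times\mathbb{R}^n, \] \[ (u,\partial_tu)|_{t=0}=\varepsilon\big(f,g\big),\qquad (v,\partial_tv)|_{t=0}=\varepsilon\big(\tilde f,\tilde g\big), \] with $\varepsilon>0$. Suppose all data $f,g,\tilde f,\tilde g$ are supported in the unit ball $B_1(0)$, and $g-f$, $f$, $\tilde g-\tilde f$, $\tilde f$ are non-negative, with $\tilde f$ not identically zero. Then for any $\varepsilon>0$ there is no global weak solution $(u,v)$ of this system such that $\operatorname{supp}(u,v)\subset\{(t,x):|x|\leq t+1\}$ and \[ u,v,\partial_tu,\partial_tv\in C\big(\mathbb{R}_+;L^1(\mathbb{R}^n)\big),\qquad v\in C\big(\mathbb{R}_+;L^q(\mathbb{R}^n)\big),\qquad \partial_tu\in C\big(\mathbb{R}_+;L^p(\mathbb{R}^n)\big), \] where $\mathbb{R}_+=[0,\infty)$. *)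

theory Defs
  imports "HOL-Analysis.Analysis"
begin

definition dderiv :: "'a::euclidean_space \<Rightarrow> ('a \<Rightarrow> real) \<Rightarrow> 'a \<Rightarrow> real" where
  "dderiv e F = (\<lambda>z. frechet_derivative F (at z) e)"

fun Ck :: "nat \<Rightarrow> ('a::euclidean_space \<Rightarrow> real) \<Rightarrow> bool" where
  "Ck 0 F = continuous_on UNIV F"
| "Ck (Suc k) F = (continuous_on UNIV F \<and> (\<forall>z. F differentiable (at z)) \<and>
                    (\<forall>e\<in>Basis. Ck k (dderiv e F)))"

definition smooth_fun :: "('a::euclidean_space \<Rightarrow> real) \<Rightarrow> bool" where
  "smooth_fun F \<longleftrightarrow> (\<forall>k. Ck k F)"

definition test_fun :: "('a::euclidean_space \<Rightarrow> real) \<Rightarrow> bool" where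
  "test_fun F \<longleftrightarrow> smooth_fun F \<and> compact (closure {z. F z \<noteq> 0})"

definition dt :: "(real \<times> (real^'n) \<Rightarrow> real) \<Rightarrow> real \<times> (real^'n) \<Rightarrow> real" where
  "dt F = dderiv (1, 0) F"

definition laplace_x :: "(real \<times> (real^'n) \<Rightarrow> real) \<Rightarrow> real \<times> (real^'n) \<Rightarrow> real" where
  "laplace_x F = (\<lambda>z. \<Sum>i\<in>(Basis :: (real^'n) set). dderiv (0, i) (dderiv (0, i) F) z)"

definition C_Lr :: "real \<Rightarrow> (real \<Rightarrow> real^'n \<Rightarrow> real) \<Rightarrow> bool" where
  "C_Lr r w \<longleftrightarrow>
     (\<forall>t\<ge>0. w t \<in> borel_measurable lborel \<and> integrable lborel (\<lambda>x. \<bar>w t x\<bar> powr r)) \<and>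
     (\<forall>t0\<ge>0. ((\<lambda>t. LINT x|lborel. \<bar>w t x - w t0 x\<bar> powr r) \<longlongrightarrow> 0) (at t0 within {0..}))"

definition st_int :: "(real \<Rightarrow> real^'n \<Rightarrow> real) \<Rightarrow> real" where
  "st_int h = (LINT t:{0..}|lborel. (LINT x|lborel. h t x))"

definition is_time_deriv :: "(real \<Rightarrow> real^'n \<Rightarrow> real) \<Rightarrow> (real \<Rightarrow> real^'n \<Rightarrow> real) \<Rightarrow> bool" where
  "is_time_deriv w w1 \<longleftrightarrow>
     (\<forall>\<phi>. test_fun \<phi> \<and> (\<forall>t x. t \<le> 0 \<longrightarrow> \<phi> (t, x) = 0) \<longrightarrow>
        st_int (\<lambda>t x. w t x * dt \<phi> (t, x)) = - st_int (\<lambda>t x. w1 t x * \<phi> (t, x)))"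

text \<open>Weak formulation of  \<partial>_t^2 w - \<Delta> w = F,  (w, \<partial>_t w)|_{t=0} = \<epsilon>(f, g),
  tested against all \<Psi> \<in> C_0^\<infinity>([0,\<infinity>) \<times> R^n).\<close>
definition weak_wave :: "real \<Rightarrow> (real^'n \<Rightarrow> real) \<Rightarrow> (real^'n \<Rightarrow> real) \<Rightarrow>
     (real \<Rightarrow> real^'n \<Rightarrow> real) \<Rightarrow> (real \<Rightarrow> real^'n \<Rightarrow> real) \<Rightarrow> bool" where
  "weak_wave \<epsilon> f g F w \<longleftrightarrow>
     (\<forall>\<Psi>. test_fun \<Psi> \<longrightarrow>
        st_int (\<lambda>t x. w t x * (dt (dt \<Psi>) (t, x) - laplace_x \<Psi> (t, x)))
        = st_int (\<lambda>t x. F t x * \<Psi> (t, x))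
          + \<epsilon> * (LINT x|lborel. g x * \<Psi> (0, x))
          - \<epsilon> * (LINT x|lborel. f x * dt \<Psi> (0, x)))"

definition global_weak_solution :: "real \<Rightarrow> real \<Rightarrow> real \<Rightarrow>
     (real^'n \<Rightarrow> real) \<Rightarrow> (real^'n \<Rightarrow> real) \<Rightarrow> (real^'n \<Rightarrow> real) \<Rightarrow> (real^'n \<Rightarrow> real) \<Rightarrow>
     (real \<Rightarrow> real^'n \<Rightarrow> real) \<Rightarrow> (real \<Rightarrow> real^'n \<Rightarrow> real) \<Rightarrow>
     (real \<Rightarrow> real^'n \<Rightarrow> real) \<Rightarrow> (real \<Rightarrow> real^'n \<Rightarrow> real) \<Rightarrow> bool" where
  "global_weak_solution p q \<epsilon> f g f' g' u u1 v v1 \<longleftrightarrow>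
     C_Lr 1 u \<and> C_Lr 1 v \<and> C_Lr 1 u1 \<and> C_Lr 1 v1 \<and> C_Lr q v \<and> C_Lr p u1 \<and>
     is_time_deriv u u1 \<and> is_time_deriv v v1 \<and>
     weak_wave \<epsilon> f g (\<lambda>t x. \<bar>v t x\<bar> powr q) u \<and>
     weak_wave \<epsilon> f' g' (\<lambda>t x. \<bar>u1 t x\<bar> powr p) v"

end

(*
The equations are tested with $\rho(t) e^{x_i}$, where $e^{x_i}$ solves $\Delta\phi = \phi$ and
$\rho(t) = e^{-t} E(1 - t/T)$ with $E(s) = e^{-1/s}$ for $s > 0$. By finite speed of propagation only
the ball of radius $t + 1$ matters, and there $e^{-t} e^{x_i}$ has mass $O(t^{(n-1)/2})$. Testing the
equation for v with $\rho$ and the one for u with $-\rho'$, followed by an integration by parts in time,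
produces on both right-hand sides the same factor $P = \rho'' - \rho$, which is small of order
$e^{-t} E^{1/r} / T$ for every r > 1:
  $c_0 + \int |u_t|^p \rho \le \int v P$  and  $\int |v|^q \rho \le \int u_t P$.
Young's inequality with weight $\kappa = T^l$ in the first and $1/\kappa$ in the second cancels the
nonlinear terms and leaves $c_0 \le B_2 T^a + B_1 T^b$; the condition on (p + 1) / (p q - 1) is exactly
what allows both exponents to be negative.
*)
theory Submission
  imports Defs "HOL-Computational_Algebra.Polynomial"
begin

section \<open>Iterated differentiability\<close>

text \<open>Both factors of \<rho> decrease in t because E increases in s, hence -\<rho>' \<ge>
  \<rho>, and testing the equation for u with -\<rho>' still controls the integral of |v|^q \<rho>.
  There u meets -P'; one integration by parts moves the derivative onto u, so that P meets u_t, the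
  quantity inside the other nonlinearity. The price is a term with u at t = 0: the weak time
  derivative is tested only with functions vanishing for t \<le> 0, and the initial value is encoded
  only in the weak formulation. Cutoffs concentrating at t = 0 supply the term, and a second such
  family recovers the weighted mean of \<epsilon> f. The profile e^{-1/s} is chosen because its
  derivatives are polynomials in 1/s times itself, and any positive power of E absorbs such
  polynomials; one profile then serves r = p and r = q. A single exponential e^{x_i} takes the place
  of a spherical mean of plane waves: it is explicit, and its mass on a ball follows by slicing the
  ball orthogonally to one axis.\<close>

lemma dderiv_eq: "(F has_derivative D) (at z) \<Longrightarrow> dderiv e F z = D e"
  unfolding dderiv_def using frechet_derivative_at by metis

lemma dderiv_has_derivative:
  assumes "F differentiable (at z)"
  shows "(F has_derivative (\<lambda>e. dderiv e F z)) (at z)"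
  using assms frechet_derivative_works unfolding dderiv_def by blast

text \<open>\<open>frechet_derivative\<close> is a choice among the derivatives at a point, so two
  functions with the same derivatives there have the same value of \<open>dderiv\<close>,
  differentiable or not.\<close>

lemma dderiv_cong_open:
  assumes "open S" "z \<in> S" "\<And>y. y \<in> S \<Longrightarrow> F y = G y"
  shows "dderiv e F z = dderiv e G z"
proof -
  have "(F has_derivative D) (at z) \<longleftrightarrow> (G has_derivative D) (at z)" for D
    using has_derivative_transform_within_open[OF _ assms(1,2)] assms(3) by metis
  then show ?thesis
    unfolding dderiv_def frechet_derivative_def by simp
qed

lemma Ck_imp_continuous: "Ck k F \<Longrightarrow> continuous_on UNIV F"
  by (cases k) auto

lemma Ck_SucD: "Ck (Suc k) F \<Longrightarrow> Ck k F"
proof (induction k arbitrary: F)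
  case (Suc k)
  then show ?case by (metis Ck.simps(2))
qed simp

lemma Ck_SucI:
  assumes "\<And>z. (F has_derivative D z) (at z)" "\<And>e. e \<in> Basis \<Longrightarrow> Ck k (\<lambda>z. D z e)"
  shows "Ck (Suc k) F"
proof -
  have "dderiv e F = (\<lambda>z. D z e)" for e
    by (rule ext) (rule dderiv_eq[OF assms(1)])
  moreover have "continuous_on UNIV F"
    by (rule continuous_at_imp_continuous_on) (use has_derivative_continuous[OF assms(1)] in simp)
  moreover have "F differentiable (at z)" for z
    by (rule differentiableI[OF assms(1)])
  ultimately show ?thesis using assms(2) by simp
qed

lemma Ck_const: "Ck k (\<lambda>z. c)"
proof (induction k arbitrary: c)
  case (Suc k)
  show ?case by (rule Ck_SucI[where D="\<lambda>z e. 0"]) (use Suc in auto)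
qed simp

lemma Ck_bounded_linear: "bounded_linear F \<Longrightarrow> Ck k F"
proof (cases k)
  case (Suc m)
  assume "bounded_linear F"
  then show ?thesis unfolding Suc
    by (intro Ck_SucI[where D="\<lambda>z. F"] Ck_const bounded_linear_imp_has_derivative)
qed (simp add: linear_continuous_on)

lemma Ck_Suc_has_derivative:
  "Ck (Suc k) F \<Longrightarrow> (F has_derivative (\<lambda>e. dderiv e F z)) (at z)"
  by (simp add: dderiv_has_derivative)

lemma Ck_add: "Ck k F \<Longrightarrow> Ck k G \<Longrightarrow> Ck k (\<lambda>z. F z + G z)"
proof (induction k arbitrary: F G)
  case 0
  then show ?case by (simp add: continuous_on_add)
next
  case (Suc k)
  show ?case
  proof (rule Ck_SucI)
    show "((\<lambda>z. F z + G z) has_derivative (\<lambda>e. dderiv e F z + dderiv e G z)) (at z)" for z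
      by (rule has_derivative_add[OF Suc.prems[THEN Ck_Suc_has_derivative]])
    show "Ck k (\<lambda>z. dderiv e F z + dderiv e G z)" if "e \<in> Basis" for e
      using Suc.prems that by (intro Suc.IH) simp_all
  qed
qed

lemma Ck_mult: "Ck k F \<Longrightarrow> Ck k G \<Longrightarrow> Ck k (\<lambda>z. F z * G z)"
proof (induction k arbitrary: F G)
  case 0
  then show ?case by (simp add: continuous_on_mult)
next
  case (Suc k)
  show ?case
  proof (rule Ck_SucI)
    show "((\<lambda>z. F z * G z) has_derivative
        (\<lambda>e. F z * dderiv e G z + dderiv e F z * G z)) (at z)" for z
      by (rule has_derivative_mult[OF Suc.prems[THEN Ck_Suc_has_derivative]])
    show "Ck k (\<lambda>z. F z * dderiv e G z + dderiv e F z * G z)" if "e \<in> Basis" for e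
      proof -
      have "Ck k F" "Ck k G" "Ck k (dderiv e F)" "Ck k (dderiv e G)"
        using that Suc.prems Ck_SucD by auto
      then show ?thesis using Ck_add Suc.IH by blast
    qed
  qed
qed

lemma has_derivative_dderiv_1:
  fixes h :: "real \<Rightarrow> real"
  assumes "h differentiable (at x)"
  shows "(h has_derivative (\<lambda>e. dderiv 1 h x * e)) (at x)"
proof -
  have d: "(h has_derivative (\<lambda>e. dderiv e h x)) (at x)"
    using assms by (rule dderiv_has_derivative)
  have "dderiv e h x = dderiv 1 h x * e" for e
  proof -
    have "dderiv e h x = dderiv (e *\<^sub>R 1) h x" by simp
    also have "\<dots> = e *\<^sub>R dderiv 1 h x"
      by (rule linear_scale[OF has_derivative_linear[OF d]])
    finally show ?thesis by (simp only: real_scaleR_def mult.commute)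
  qed
  then have "(\<lambda>e. dderiv e h x) = (\<lambda>e. dderiv 1 h x * e)" by (rule ext)
  with d show ?thesis by (simp only:)
qed

lemma Ck_compose:
  fixes h :: "real \<Rightarrow> real"
  shows "Ck k h \<Longrightarrow> Ck k F \<Longrightarrow> Ck k (\<lambda>z. h (F z))"
proof (induction k arbitrary: h F)
  case 0
  then show ?case by (auto intro: continuous_on_compose2)
next
  case (Suc k)
  show ?case
  proof (rule Ck_SucI)
    fix z
    have h: "(h has_derivative (\<lambda>e. dderiv 1 h (F z) * e)) (at (F z))"
      using Suc.prems(1) by (simp add: dderiv_has_derivative has_derivative_dderiv_1)
    show "((\<lambda>z. h (F z)) has_derivative (\<lambda>e. dderiv 1 h (F z) * dderiv e F z)) (at z)"
      using has_derivative_compose[OF Ck_Suc_has_derivative[OF Suc.prems(2)] h] by simp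
    show "Ck k (\<lambda>z. dderiv 1 h (F z) * dderiv e F z)" if "e \<in> Basis" for e
      proof -
      have "Ck k F" "Ck k (dderiv 1 h)" "Ck k (dderiv e F)"
        using that Suc.prems Ck_SucD by auto
      then show ?thesis using Ck_mult Suc.IH by blast
    qed
  qed
qed

lemma smooth_fun_dderiv: "smooth_fun F \<Longrightarrow> e \<in> Basis \<Longrightarrow> smooth_fun (dderiv e F)"
  unfolding smooth_fun_def by (metis Ck.simps(2))

lemma smooth_fun_continuous: "smooth_fun F \<Longrightarrow> continuous_on S F"
  unfolding smooth_fun_def using Ck_imp_continuous continuous_on_subset by blast

lemma smooth_fun_has_derivative:
  "smooth_fun F \<Longrightarrow> (F has_derivative (\<lambda>e. dderiv e F z)) (at z)"
  unfolding smooth_fun_def using Ck_Suc_has_derivative by blast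

lemma smooth_fun_const: "smooth_fun (\<lambda>z. c)"
  and smooth_fun_bounded_linear: "bounded_linear F \<Longrightarrow> smooth_fun F"
  and smooth_fun_add: "smooth_fun F \<Longrightarrow> smooth_fun G \<Longrightarrow> smooth_fun (\<lambda>z. F z + G z)"
  and smooth_fun_mult: "smooth_fun F \<Longrightarrow> smooth_fun G \<Longrightarrow> smooth_fun (\<lambda>z. F z * G z)"
  unfolding smooth_fun_def
  by (auto intro: Ck_const Ck_bounded_linear Ck_add Ck_mult)

lemma smooth_fun_compose:
  fixes h :: "real \<Rightarrow> real"
  shows "smooth_fun h \<Longrightarrow> smooth_fun F \<Longrightarrow> smooth_fun (\<lambda>z. h (F z))"
  unfolding smooth_fun_def by (auto intro: Ck_compose)

lemma smooth_fun_minus: "smooth_fun F \<Longrightarrow> smooth_fun (\<lambda>z. - F z)"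
  using smooth_fun_mult[OF smooth_fun_const[of "-1"]] by simp

lemma smooth_fun_diff: "smooth_fun F \<Longrightarrow> smooth_fun G \<Longrightarrow> smooth_fun (\<lambda>z. F z - G z)"
  using smooth_fun_add[OF _ smooth_fun_minus] by simp

lemma smooth_fun_real_deriv:
  fixes h :: "real \<Rightarrow> real"
  assumes "smooth_fun h"
  shows "(h has_real_derivative dderiv 1 h x) (at x)"
proof -
  have "h differentiable (at x)"
    using smooth_fun_has_derivative[OF assms] by (rule differentiableI)
  then show ?thesis
    unfolding has_field_derivative_def by (rule has_derivative_dderiv_1)
qed

lemma dderiv_real_eq:
  fixes h :: "real \<Rightarrow> real"
  assumes "(h has_real_derivative d) (at x)"
  shows "dderiv 1 h x = d"
  using dderiv_eq[of h "(*) d" x 1] assms by (simp add: has_field_derivative_def)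

text \<open>Smoothness of families closed under differentiation: the constant sequence gives
  \<open>exp\<close>, and the iterates of \<open>flat_step\<close> give every
  \<open>flat P\<close>.\<close>

lemma smooth_fun_derivative_sequence:
  fixes D :: "nat \<Rightarrow> real \<Rightarrow> real"
  assumes "\<And>j x. (D j has_real_derivative D (Suc j) x) (at x)"
  shows "smooth_fun (D j)"
proof -
  have "Ck k (D j)" for k
  proof (induction k arbitrary: j)
    case 0
    show ?case
      using DERIV_isCont[OF assms] by (simp add: continuous_at_imp_continuous_on)
  next
    case (Suc k)
    show ?case
    proof (rule Ck_SucI)
      show "(D j has_derivative (*) (D (Suc j) z)) (at z)" for z
        using assms by (simp add: has_field_derivative_def)
      show "Ck k (\<lambda>z. D (Suc j) z * e)" if "e \<in> Basis" for e
        using Suc that by simp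
    qed
  qed
  then show ?thesis unfolding smooth_fun_def by blast
qed

lemma smooth_fun_exp: "smooth_fun (exp :: real \<Rightarrow> real)"
  using smooth_fun_derivative_sequence[where D="\<lambda>_. exp"] DERIV_exp by blast

section \<open>Flat functions and a smooth cutoff\<close>

text \<open>Products of polynomials in $1/x$ with $e^{-1/x}$ are closed under differentiation.\<close>

definition flat :: "real poly \<Rightarrow> real \<Rightarrow> real" where
  "flat P x = (if x > 0 then poly P (1/x) * exp (-1/x) else 0)"

text \<open>With y = 1/x one has dy/dx = -y^2 and d/dy (P e^{-y}) = (P' - P) e^{-y}; the derivative
  is therefore y^2 (P - P') e^{-y}, and \<open>[:0,0,1:]\<close> is y^2.\<close>

definition flat_step :: "real poly \<Rightarrow> real poly" where
  "flat_step P = [:0,0,1:] * (P - pderiv P)"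

lemma poly_exp_tendsto_0: "((\<lambda>y. poly P y * exp (-y)) \<longlongrightarrow> (0::real)) at_top"
proof -
  have "((\<lambda>y. y ^ k * exp (-y)) \<longlongrightarrow> (0::real)) at_top" for k
    using tendsto_power_div_exp_0[of k] by (simp add: exp_minus divide_inverse)
  then have "((\<lambda>y. \<Sum>k\<le>degree P. coeff P k * (y ^ k * exp (-y))) \<longlongrightarrow> (\<Sum>k\<le>degree P. coeff P k * 0)) at_top"
    by (intro tendsto_sum tendsto_mult tendsto_const)
  then show ?thesis
    by (simp add: poly_altdef sum_distrib_right mult.assoc)
qed

lemma flat_has_derivative: "(flat P has_real_derivative flat (flat_step P) x) (at x)"
proof -
  consider "x > 0" | "x < 0" | "x = 0" by linarith
  then show ?thesis
  proof cases
    case 1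
    have "((\<lambda>x. poly P (1/x) * exp (-1/x)) has_real_derivative flat (flat_step P) x) (at x)"
      using 1 by (auto intro!: derivative_eq_intros poly_DERIV[THEN DERIV_chain2]
          simp: flat_def flat_step_def field_simps power2_eq_square)
    then show ?thesis
      by (rule has_field_derivative_transform_within_open[where S="{0<..}"])
        (use 1 in \<open>auto simp: flat_def\<close>)
  next
    case 2
    have "((\<lambda>x. 0) has_real_derivative flat (flat_step P) x) (at x)"
      using 2 by (simp add: flat_def)
    then show ?thesis
      by (rule has_field_derivative_transform_within_open[where S="{..<0}"])
        (use 2 in \<open>auto simp: flat_def\<close>)
  next
    case 3
    \<comment> \<open>With y = 1/h the right difference quotient at 0 is y P(y) e^{-y}, and
      \<open>pCons 0 P\<close> represents y P(y).\<close>
    have "((\<lambda>h. poly (pCons 0 P) (1/h) * exp (-(1/h))) \<longlongrightarrow> 0) (at_right 0)"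
      by (rule filterlim_compose[OF poly_exp_tendsto_0])
        (simp add: filterlim_inverse_at_top_right[unfolded inverse_eq_divide])
    then have r: "((\<lambda>h. (flat P (0 + h) - flat P 0) / h) \<longlongrightarrow> 0) (at_right 0)"
      by (rule Lim_transform_eventually)
        (auto simp: flat_def eventually_at_right_field intro!: exI[of _ 1])
    have l: "((\<lambda>h. (flat P (0 + h) - flat P 0) / h) \<longlongrightarrow> 0) (at_left 0)"
      by (rule Lim_transform_eventually[OF tendsto_const])
        (auto simp: flat_def eventually_at_left_field intro!: exI[of _ "-1"])
    have "((\<lambda>h. (flat P (0 + h) - flat P 0) / h) \<longlongrightarrow> 0) (at 0)"
      using r l filterlim_split_at by blast
    then show ?thesis using 3 by (simp add: DERIV_def flat_def)
  qed
qed

lemma smooth_fun_flat: "smooth_fun (flat P)"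
  using smooth_fun_derivative_sequence[where D="\<lambda>j. flat ((flat_step ^^ j) P)" and j=0] flat_has_derivative
  by simp

lemma flat_mono_one: "x \<le> y \<Longrightarrow> flat 1 x \<le> flat 1 y"
  by (auto simp: flat_def field_simps)

lemma flat_one_nonneg: "0 \<le> flat 1 x"
  by (simp add: flat_def)

text \<open>A smooth step from two nested copies of E(x) = e^{-1/x}, with no integral of a bump: the
  inner E(x - 1/2) vanishes up to x = 1/2 and exceeds E(1/2) from x = 1 on, where the argument of
  the outer copy is no longer positive. The denominator is the value of the outer copy for x \<le>
  1/2.\<close>

definition plateau :: "real \<Rightarrow> real" where
  "plateau x = flat 1 (flat 1 (1/2) - flat 1 (x - 1/2)) / flat 1 (flat 1 (1/2))"

lemma smooth_fun_plateau: "smooth_fun plateau"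
proof -
  have "smooth_fun (\<lambda>x. flat 1 (flat 1 (1/2) - flat 1 (x + (-1/2))) * (1 / flat 1 (flat 1 (1/2))))"
    by (intro smooth_fun_compose[OF smooth_fun_flat] smooth_fun_diff smooth_fun_add
        smooth_fun_const smooth_fun_mult smooth_fun_bounded_linear bounded_linear_ident)
  then show ?thesis unfolding plateau_def[abs_def] by simp
qed

lemma plateau_eq_1: "x \<le> 1/2 \<Longrightarrow> plateau x = 1"
  and plateau_eq_0: "1 \<le> x \<Longrightarrow> plateau x = 0"
  and plateau_nonneg: "0 \<le> plateau x"
  and plateau_le_1: "plateau x \<le> 1"
proof -
  have pos: "0 < flat 1 (flat 1 (1/2))" by (simp add: flat_def)
  show "x \<le> 1/2 \<Longrightarrow> plateau x = 1" using pos by (simp add: plateau_def flat_def)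
  show "0 \<le> plateau x" by (simp add: plateau_def flat_one_nonneg)
  show "plateau x \<le> 1"
    using pos flat_mono_one[of "flat 1 (1/2) - flat 1 (x - 1/2)" "flat 1 (1/2)"]
    by (simp add: plateau_def flat_one_nonneg)
  assume "1 \<le> x"
  then have "flat 1 (1/2) - flat 1 (x - 1/2) \<le> 0" using flat_mono_one[of "1/2" "x - 1/2"] by simp
  then show "plateau x = 0" by (simp add: plateau_def flat_def[of 1 "flat 1 (1/2) - flat 1 (x - 1/2)"])
qed

section \<open>Exponentially weighted volume of balls\<close>

text \<open>Raise z \<le> e^z, taken at z = a y / k, to the power k.\<close>

lemma power_le_exp:
  fixes y a :: real
  assumes "y \<ge> 0" "a > 0"
  shows "y ^ k \<le> (real k / a) ^ k * exp (a * y)"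
proof (cases "k = 0")
  case False
  have "a * y / real k \<le> exp (a * y / real k)"
    using exp_ge_add_one_self[of "a * y / real k"] by linarith
  then have "y \<le> real k / a * exp (a * y / real k)"
    using False assms by (simp add: field_simps)
  then have "y ^ k \<le> (real k / a * exp (a * y / real k)) ^ k"
    using assms by (intro power_mono) auto
  also have "\<dots> = (real k / a) ^ k * exp (a * y)"
    using False unfolding power_mult_distrib by (simp add: exp_of_nat_mult[symmetric])
  finally show ?thesis .
qed (use assms in auto)

lemma summable_slabs:
  fixes \<mu> :: real
  assumes "\<mu> \<ge> 0"
  shows "summable (\<lambda>k. exp (- real k) * (8 * (real k + 1)) powr \<mu>)"
proof -
  obtain m :: nat where m: "\<mu> \<le> real m" using real_arch_simple by blast
  \<comment> \<open>The rate 1/16 turns 8 (k + 1) into the exponent (k + 1)/2, so half of the decay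
    of e^{-k} remains and gives a geometric series.\<close>
  define K where "K = (real m / (1/16)) ^ m * exp (1/2)"
  have "exp (- real k) * (8 * (real k + 1)) powr \<mu> \<le> K * exp (-1/2) ^ k" for k
  proof -
    have "(8 * (real k + 1)) powr \<mu> \<le> (8 * (real k + 1)) powr real m"
      using m by (intro powr_mono) auto
    also have "\<dots> = (8 * (real k + 1)) ^ m" by (simp add: powr_realpow)
    also have "\<dots> \<le> (real m / (1/16)) ^ m * exp (1/16 * (8 * (real k + 1)))"
      by (rule power_le_exp) auto
    also have "\<dots> = K * exp (real k / 2)"
      by (simp add: K_def exp_add[symmetric] algebra_simps add_divide_distrib)
    finally have "exp (- real k) * (8 * (real k + 1)) powr \<mu> \<le> exp (- real k) * (K * exp (real k / 2))"
      by (intro mult_left_mono) auto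
    also have "\<dots> = K * exp (- real k / 2)"
      by (simp add: exp_add[symmetric] mult.left_commute)
    also have "exp (- real k / 2) = exp (-1/2) ^ k"
      by (simp add: exp_of_nat_mult[symmetric])
    finally show ?thesis .
  qed
  moreover have "summable (\<lambda>k. K * exp (-1/2) ^ k)"
    by (intro summable_mult summable_geometric) simp
  ultimately show ?thesis
    by (auto intro: summable_comparison_test'[where N=0 and g="\<lambda>k. K * exp (-1/2) ^ k"])
qed

lemma prod_if_one_cart:
  fixes c :: real
  shows "(\<Prod>j\<in>(UNIV :: 'n::finite set). if j = i then 1 else c) = c ^ (CARD('n) - 1)"
proof -
  have "(\<Prod>j\<in>(UNIV :: 'n set). if j = i then 1 else c) = (\<Prod>j\<in>UNIV - {i}. if j = i then 1 else c)"
    by (subst prod.remove[of _ i]) auto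
  also have "\<dots> = (\<Prod>j\<in>UNIV - {i}. c)" by (rule prod.cong) auto
  finally show ?thesis by (simp add: card_Diff_singleton)
qed

text \<open>The part of the ball of radius \<open>R\<close> where the coordinate \<open>i\<close> lies between \<open>R - k - 1\<close> and
  \<open>R - k\<close> has extent at most \<open>2 * sqrt (2 * R * (k + 1))\<close> in the other directions.\<close>

definition slab :: "'n \<Rightarrow> real \<Rightarrow> nat \<Rightarrow> (real^'n) set" where
  "slab i R k = cbox (\<chi> j. if j = i then R - real k - 1 else - sqrt (2 * R * (real k + 1)))
                     (\<chi> j. if j = i then R - real k else sqrt (2 * R * (real k + 1)))"

lemma integrable_slab: "integrable lborel (indicator (slab i R k) :: (real^'n) \<Rightarrow> real)"
  using emeasure_lborel_cbox_finite unfolding slab_def infinity_ennreal_def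
  by (intro integrable_real_indicator) auto

lemma measure_slab:
  fixes i :: "'n::finite"
  assumes "R > 0"
  shows "measure lborel (slab i R k) = (8 * R * (real k + 1)) powr ((real CARD('n) - 1) / 2)"
proof -
  define s where "s = sqrt (2 * R * (real k + 1))"
  have s: "s \<ge> 0" using assms by (simp add: s_def)
  have eq: "slab i R k = cbox (\<chi> j. if j = i then R - real k - 1 else - s) (\<chi> j. if j = i then R - real k else s)"
    unfolding slab_def s_def ..
  have "(\<chi> j. if j = i then R - real k - 1 else - s) \<in> slab i R k"
    using s by (simp add: eq mem_box_cart)
  then have "measure lborel (slab i R k) = (\<Prod>j\<in>UNIV. if j = i then 1 else 2 * s)"
    unfolding eq by (subst content_cbox_cart) (auto intro!: prod.cong)
  also have "\<dots> = (2 * s) ^ (CARD('n) - 1)" by (rule prod_if_one_cart)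
  also have "2 * s = (8 * R * (real k + 1)) powr (1/2)"
  proof -
    have "8 * R * (real k + 1) = 2\<^sup>2 * (2 * R * (real k + 1))" by simp
    then have "sqrt (8 * R * (real k + 1)) = 2 * s"
      unfolding s_def by (simp only: real_sqrt_mult real_sqrt_abs abs_numeral)
    then show ?thesis using assms by (simp add: powr_half_sqrt)
  qed
  also have "((8 * R * (real k + 1)) powr (1/2)) ^ (CARD('n) - 1)
      = (8 * R * (real k + 1)) powr ((real CARD('n) - 1) / 2)"
  proof -
    have "8 * R * (real k + 1) > 0" using assms by simp
    then have "((8 * R * (real k + 1)) powr (1/2)) ^ (CARD('n) - 1)
       = ((8 * R * (real k + 1)) powr (1/2)) powr real (CARD('n) - 1)"
      by (subst powr_realpow) auto
    also have "real (CARD('n) - 1) = real CARD('n) - 1"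
      by (simp add: of_nat_diff)
    finally show ?thesis by (simp add: powr_powr)
  qed
  finally show ?thesis .
qed

text \<open>For j \<noteq> i the ball gives x_j^2 \<le> R^2 - x_i^2 = (R + x_i)(R - x_i), where the
  first factor is at most 2 R and the second at most k + 1.\<close>

lemma mem_slab:
  fixes x :: "real^'n"
  assumes "norm x \<le> R"
  shows "x \<in> slab i R (nat \<lfloor>R - x $ i\<rfloor>)"
proof -
  have xi: "\<bar>x $ i\<bar> \<le> R" using component_le_norm_cart[of x i] assms by linarith
  define k where "k = nat \<lfloor>R - x $ i\<rfloor>"
  have k: "real k \<le> R - x $ i" "R - x $ i < real k + 1"
    using xi by (auto simp: k_def)
  have "\<bar>x $ j\<bar> \<le> sqrt (2 * R * (real k + 1))" if "j \<noteq> i" for j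
  proof (rule real_le_rsqrt)
    have "(x $ j)\<^sup>2 + (x $ i)\<^sup>2 = (\<Sum>l\<in>{j,i}. (x $ l)\<^sup>2)" using that by simp
    also have "\<dots> \<le> (\<Sum>l\<in>UNIV. (x $ l)\<^sup>2)" by (rule sum_mono2) auto
    also have "\<dots> = (norm x)\<^sup>2" by (simp add: norm_vec_def L2_set_def sum_nonneg)
    also have "\<dots> \<le> R\<^sup>2" using assms by (intro power_mono) auto
    finally have "(x $ j)\<^sup>2 \<le> (R + x $ i) * (R - x $ i)" by (simp add: power2_eq_square algebra_simps)
    also have "\<dots> \<le> (2 * R) * (real k + 1)" using xi k by (intro mult_mono) auto
    finally show "\<bar>x $ j\<bar>\<^sup>2 \<le> 2 * R * (real k + 1)" by simp
  qed
  then have "- sqrt (2 * R * (real k + 1)) \<le> x $ j \<and> x $ j \<le> sqrt (2 * R * (real k + 1))"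
    if "j \<noteq> i" for j using that abs_le_iff[of "x $ j"] by fastforce
  then show ?thesis using k unfolding k_def[symmetric] slab_def mem_box_cart by simp
qed

text \<open>The exponential is concentrated near the pole of the ball: on slab k it is at most
  e^{R-k}, while the slab has volume (8 R (k + 1))^{(n-1)/2}. The power of R factors out and the sum
  over k converges. This yields R^{(n-1)/2} instead of the R^n that the volume of the whole ball
  would give, and the exponent condition of the theorem depends on this gain.\<close>

lemma integral_exp_ball_le:
  obtains C :: real where "C > 0"
    "\<And>(R::real) (i::'n::finite) (w :: real^'n \<Rightarrow> real). R > 0 \<Longrightarrow> w \<in> borel_measurable lborel \<Longrightarrow>
       (\<And>x. norm (w x) \<le> exp (x $ i) * indicator (cball 0 R) x) \<Longrightarrow>
       integrable lborel w \<and> (LINT x|lborel. w x) \<le> C * R powr ((real CARD('n) - 1) / 2) * exp R"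
proof -
  define \<mu> where "\<mu> = (real CARD('n) - 1) / 2"
  have \<mu>: "\<mu> \<ge> 0" by (simp add: \<mu>_def)
  let ?a = "\<lambda>k. exp (- real k) * (8 * (real k + 1)) powr \<mu>"
  define C where "C = suminf ?a + 1"
  have sm: "summable ?a" by (rule summable_slabs[OF \<mu>])
  show ?thesis
  proof
    show "C > 0" using suminf_nonneg[OF sm] by (simp add: C_def)
    fix R :: real and i :: 'n and w :: "real^'n \<Rightarrow> real"
    assume R: "R > 0" and w: "w \<in> borel_measurable lborel"
      "\<And>x. norm (w x) \<le> exp (x $ i) * indicator (cball 0 R) x"
    \<comment> \<open>In the ball R - x_i lies between 0 and 2 R, so all slab indices are below
      N.\<close>
    define N where "N = nat \<lfloor>2 * R\<rfloor> + 1"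
    define g where "g x = (\<Sum>k<N. exp (R - real k) * indicator (slab i R k) x)" for x :: "real^'n"
    have g: "integrable lborel g"
      unfolding g_def by (intro Bochner_Integration.integrable_sum integrable_mult_right integrable_slab)
    have le: "norm (w x) \<le> g x" for x
    proof (cases "norm x \<le> R")
      case True
      define k where "k = nat \<lfloor>R - x $ i\<rfloor>"
      have xi: "\<bar>x $ i\<bar> \<le> R" using component_le_norm_cart[of x i] True by linarith
      have "k < N" unfolding k_def N_def using xi by (auto intro!: nat_mono floor_mono simp: less_Suc_eq_le)
      have "real k \<le> R - x $ i" using xi by (simp add: k_def)
      then have "norm (w x) \<le> exp (R - real k) * indicator (slab i R k) x"
        using w(2)[of x] mem_slab[OF True, of i] True by (auto simp: k_def[symmetric] intro: order_trans)
      also have "\<dots> \<le> g x"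
        unfolding g_def using \<open>k < N\<close> by (intro member_le_sum) auto
      finally show ?thesis .
    next
      case False
      then have "norm (w x) \<le> 0" using w(2)[of x] by simp
      also have "0 \<le> g x" unfolding g_def by (intro sum_nonneg) simp
      finally show ?thesis .
    qed
    have iw: "integrable lborel w"
      by (rule Bochner_Integration.integrable_bound[OF g w(1)]) (use le in \<open>simp add: order_trans[OF _ abs_ge_self]\<close>)
    have "(LINT x|lborel. w x) \<le> (LINT x|lborel. g x)"
      by (rule integral_mono[OF iw g]) (use le in \<open>simp add: abs_le_iff\<close>)
    also have "\<dots> = (\<Sum>k<N. exp (R - real k) * measure lborel (slab i R k))"
      unfolding g_def
      by (subst Bochner_Integration.integral_sum) (auto intro!: integrable_mult_right integrable_slab)
    also have "\<dots> = R powr \<mu> * exp R * (\<Sum>k<N. ?a k)"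
    proof -
      have "exp (R - real k) * measure lborel (slab i R k) = R powr \<mu> * exp R * ?a k" for k
      proof -
        have "(8 * R * (real k + 1)) powr \<mu> = R powr \<mu> * (8 * (real k + 1)) powr \<mu>"
          using R powr_mult[of R "8 * (real k + 1)" \<mu>] by (simp add: mult_ac)
        moreover have "exp (R - real k) = exp R * exp (- real k)"
          by (simp add: exp_add[symmetric])
        ultimately show ?thesis using measure_slab[OF R, of i k] by (simp add: \<mu>_def)
      qed
      then show ?thesis by (simp only: sum_distrib_left)
    qed
    also have "(\<Sum>k<N. ?a k) \<le> C"
      using sum_le_suminf[OF sm, of "{..<N}"] by (simp add: C_def)
    finally have "(LINT x|lborel. w x) \<le> R powr \<mu> * exp R * C"
      by (simp add: mult_left_mono)
    then show "integrable lborel w \<and> (LINT x|lborel. w x) \<le> C * R powr ((real CARD('n) - 1) / 2) * exp R"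
      using iw by (simp add: \<mu>_def mult_ac)
  qed
qed

section \<open>Continuity in time of weighted integrals\<close>

text \<open>By homogeneity: if |a - b| is small compared with |b|, the ratio |a|/|b| is near 1 and
  continuity of x^q at 1 gives the first term; otherwise both |a| and |b| are bounded by a multiple
  of |a - b|, which gives the second.\<close>

lemma powr_diff_le:
  fixes q \<delta> :: real
  assumes "q > 1" "\<delta> > 0"
  obtains C where "C > 0"
    "\<And>a b :: real. \<bar>\<bar>a\<bar> powr q - \<bar>b\<bar> powr q\<bar> \<le> \<delta> * \<bar>b\<bar> powr q + C * \<bar>a - b\<bar> powr q"
proof -
  have "isCont (\<lambda>x::real. x powr q) 1" by (intro continuous_intros) auto
  then obtain e0 where e0: "e0 > 0" "\<And>x::real. dist x 1 < e0 \<Longrightarrow> dist (x powr q) (1 powr q) < \<delta>"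
    using assms(2) unfolding continuous_at_eps_delta by blast
  define e where "e = e0 / 2"
  have e: "e > 0" using e0 by (simp add: e_def)
  have ex: "\<bar>x powr q - 1\<bar> \<le> \<delta>" if "\<bar>x - 1\<bar> \<le> e" for x :: real
    using e0(2)[of x] e0(1) that by (simp add: e_def dist_real_def)
  show ?thesis
  proof
    show "(1 + 1 / e) powr q > 0" using e by (simp add: add_pos_pos less_imp_neq[symmetric])
    fix a b :: real
    show "\<bar>\<bar>a\<bar> powr q - \<bar>b\<bar> powr q\<bar> \<le> \<delta> * \<bar>b\<bar> powr q + (1 + 1 / e) powr q * \<bar>a - b\<bar> powr q"
    proof (cases "\<bar>a - b\<bar> \<le> e * \<bar>b\<bar>")
      case True
      show ?thesis
      proof (cases "b = 0")
        case False
        define x where "x = \<bar>a\<bar> / \<bar>b\<bar>"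
        have "\<bar>\<bar>a\<bar> - \<bar>b\<bar>\<bar> \<le> e * \<bar>b\<bar>" using True by linarith
        moreover have "x - 1 = (\<bar>a\<bar> - \<bar>b\<bar>) / \<bar>b\<bar>" using False by (simp add: x_def diff_divide_distrib)
        ultimately have "\<bar>x - 1\<bar> \<le> e" using False by (simp only: abs_divide) (simp add: divide_le_eq)
        then have "\<bar>x powr q - 1\<bar> * \<bar>b\<bar> powr q \<le> \<delta> * \<bar>b\<bar> powr q"
          by (intro mult_right_mono ex) auto
        moreover have "\<bar>a\<bar> powr q = x powr q * \<bar>b\<bar> powr q"
          using False by (simp add: x_def powr_mult[symmetric])
        then have "\<bar>\<bar>a\<bar> powr q - \<bar>b\<bar> powr q\<bar> = \<bar>x powr q - 1\<bar> * \<bar>b\<bar> powr q"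
          using abs_mult[of "x powr q - 1" "\<bar>b\<bar> powr q"] by (simp add: left_diff_distrib)
        ultimately show ?thesis by (simp add: add_increasing2)
      qed (use True in auto)
    next
      case False
      then have b: "\<bar>b\<bar> \<le> 1 / e * \<bar>a - b\<bar>" using e by (simp add: field_simps)
      have "\<bar>a\<bar> \<le> (1 + 1 / e) * \<bar>a - b\<bar>" "\<bar>b\<bar> \<le> (1 + 1 / e) * \<bar>a - b\<bar>"
        using b by (auto simp: distrib_right)
      then have "\<bar>a\<bar> powr q \<le> ((1 + 1 / e) * \<bar>a - b\<bar>) powr q" "\<bar>b\<bar> powr q \<le> ((1 + 1 / e) * \<bar>a - b\<bar>) powr q"
        using assms by (auto intro!: powr_mono2)
      then have "\<bar>\<bar>a\<bar> powr q - \<bar>b\<bar> powr q\<bar> \<le> ((1 + 1 / e) * \<bar>a - b\<bar>) powr q"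
        unfolding abs_le_iff using powr_ge_zero[of "\<bar>a\<bar>" q] powr_ge_zero[of "\<bar>b\<bar>" q] by linarith
      then show ?thesis using assms e by (simp add: powr_mult add_increasing)
    qed
  qed
qed

lemma integrable_diff_powr:
  fixes a b :: "'a \<Rightarrow> real"
  assumes "q > 1" "a \<in> borel_measurable M" "b \<in> borel_measurable M"
    "integrable M (\<lambda>x. \<bar>a x\<bar> powr q)" "integrable M (\<lambda>x. \<bar>b x\<bar> powr q)"
  shows "integrable M (\<lambda>x. \<bar>a x - b x\<bar> powr q)"
proof (rule Bochner_Integration.integrable_bound)
  show "integrable M (\<lambda>x. 2 powr q * (\<bar>a x\<bar> powr q + \<bar>b x\<bar> powr q))"
    using assms by simp
  have "\<bar>a x - b x\<bar> powr q \<le> 2 powr q * (\<bar>a x\<bar> powr q + \<bar>b x\<bar> powr q)" for x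
  proof -
    have "\<bar>a x - b x\<bar> powr q \<le> (2 * max \<bar>a x\<bar> \<bar>b x\<bar>) powr q"
      using assms by (intro powr_mono2) auto
    also have "\<dots> = 2 powr q * max \<bar>a x\<bar> \<bar>b x\<bar> powr q"
      by (simp add: powr_mult)
    also have "\<dots> \<le> 2 powr q * (\<bar>a x\<bar> powr q + \<bar>b x\<bar> powr q)"
      by (intro mult_left_mono) (auto simp: max_def)
    finally show ?thesis .
  qed
  then show "AE x in M. norm (\<bar>a x - b x\<bar> powr q) \<le> norm (2 powr q * (\<bar>a x\<bar> powr q + \<bar>b x\<bar> powr q))"
    by (auto simp: abs_mult intro: order_trans)
qed (use assms in measurable)

lemma C_Lr_D:
  assumes "C_Lr r w" "t \<ge> 0"
  shows "w t \<in> borel_measurable borel" "integrable lborel (\<lambda>x. \<bar>w t x\<bar> powr r)"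
    "((\<lambda>s. LINT x|lborel. \<bar>w s x - w t x\<bar> powr r) \<longlongrightarrow> 0) (at t within {0..})"
  using assms unfolding C_Lr_def by auto

lemma C_Lr_1_integrable:
  assumes "C_Lr 1 w" "t \<ge> 0"
  shows "integrable lborel (w t)"
  using C_Lr_D[OF assms] by (simp add: integrable_abs_iff)

text \<open>Places the nonlinearities |v|^q and |u_t|^p in the class C([0,\<infinity>); L^1), so
  that they are handled like u and v themselves. In \<open>powr_diff_le\<close> the first term is
  small through \<delta>, the second through continuity in L^q.\<close>

lemma C_Lr_powr:
  fixes v :: "real \<Rightarrow> real^'n \<Rightarrow> real"
  assumes "C_Lr q v" "q > 1"
  shows "C_Lr 1 (\<lambda>t x. \<bar>v t x\<bar> powr q)"
proof -
  note v = C_Lr_D[OF assms(1)]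
  have "((\<lambda>t. LINT x|lborel. \<bar>\<bar>v t x\<bar> powr q - \<bar>v s x\<bar> powr q\<bar>) \<longlongrightarrow> 0) (at s within {0..})"
    if s: "s \<ge> 0" for s
  proof (rule tendstoI)
    fix e :: real assume e: "e > 0"
    define N where "N = (LINT x|lborel. \<bar>v s x\<bar> powr q)"
    have N: "N \<ge> 0" by (simp add: N_def)
    \<comment> \<open>Adding 1 to N keeps the denominator positive when v vanishes at time
      s.\<close>
    define \<delta> where "\<delta> = e / (2 * (N + 1))"
    have \<delta>: "\<delta> > 0" using e N by (simp add: \<delta>_def)
    obtain C where C: "C > 0"
      "\<And>a b :: real. \<bar>\<bar>a\<bar> powr q - \<bar>b\<bar> powr q\<bar> \<le> \<delta> * \<bar>b\<bar> powr q + C * \<bar>a - b\<bar> powr q"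
      using powr_diff_le[OF assms(2) \<delta>] by metis
    have "\<forall>\<^sub>F t in at s within {0..}. (LINT x|lborel. \<bar>v t x - v s x\<bar> powr q) < e / (2 * C)"
      using order_tendstoD(2)[OF v(3)[OF s]] e C by simp
    moreover have "\<forall>\<^sub>F t in at s within {0..}. t \<ge> 0"
      by (simp add: eventually_at_filter)
    ultimately show "\<forall>\<^sub>F t in at s within {0..}.
        dist (LINT x|lborel. \<bar>\<bar>v t x\<bar> powr q - \<bar>v s x\<bar> powr q\<bar>) 0 < e"
    proof eventually_elim
      case (elim t)
      have i: "integrable lborel (\<lambda>x. \<bar>v t x - v s x\<bar> powr q)"
        using assms(2) v[OF elim(2)] v[OF s] by (intro integrable_diff_powr) auto
      have "(LINT x|lborel. \<bar>\<bar>v t x\<bar> powr q - \<bar>v s x\<bar> powr q\<bar>)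
          \<le> (LINT x|lborel. \<delta> * \<bar>v s x\<bar> powr q + C * \<bar>v t x - v s x\<bar> powr q)"
        using v[OF elim(2)] v[OF s] i C(2) by (intro integral_mono) auto
      also have "\<dots> = \<delta> * N + C * (LINT x|lborel. \<bar>v t x - v s x\<bar> powr q)"
        using v[OF s] i by (simp add: N_def)
      also have "\<delta> * N \<le> e / 2"
        using N e by (simp add: \<delta>_def field_simps)
      also have "C * (LINT x|lborel. \<bar>v t x - v s x\<bar> powr q) < e / 2"
        using elim(1) C(1) by (simp add: field_simps)
      finally show ?case by (simp add: dist_real_def)
    qed
  qed
  then show ?thesis using v unfolding C_Lr_def by auto
qed

text \<open>The weight may grow exponentially in x, but its support at each time is bounded; on a
  compact time interval it is thus bounded and uniformly continuous. The difference of integrands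
  splits into \<omega>(t) (w(t) - w(s)), controlled by continuity in L^1, and (\<omega>(t) -
  \<omega>(s)) w(s), controlled by uniform continuity.\<close>

lemma continuous_weighted_integral:
  fixes w :: "real \<Rightarrow> real^'n \<Rightarrow> real" and \<omega> :: "real \<times> (real^'n) \<Rightarrow> real"
  assumes w: "C_Lr 1 w" and \<omega>: "continuous_on UNIV \<omega>"
    and supp: "\<And>t x. t \<ge> 0 \<Longrightarrow> norm x > t + 2 \<Longrightarrow> \<omega> (t, x) = 0"
  shows "t \<ge> 0 \<Longrightarrow> integrable lborel (\<lambda>x. w t x * \<omega> (t, x))"
    and "continuous_on {0..} (\<lambda>t. LINT x|lborel. w t x * \<omega> (t, x))"
proof -
  have bdd: "\<exists>M>0. \<forall>t\<in>{0..T}. \<forall>x. \<bar>\<omega> (t, x)\<bar> \<le> M" for T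
  proof -
    have "compact ({0..T} \<times> cball (0::real^'n) (T + 2))" by (intro compact_Times) auto
    then have "bounded (\<omega> ` ({0..T} \<times> cball (0::real^'n) (T + 2)))"
      by (intro compact_imp_bounded compact_continuous_image continuous_on_subset[OF \<omega>]) auto
    then obtain M where M: "M > 0" "\<And>z. z \<in> {0..T} \<times> cball (0::real^'n) (T + 2) \<Longrightarrow> \<bar>\<omega> z\<bar> \<le> M"
      unfolding bounded_pos by auto
    have "\<bar>\<omega> (t, x)\<bar> \<le> M" if "t \<in> {0..T}" for t x
      using M(2)[of "(t, x)"] M(1) supp[of t x] that by (cases "norm x > t + 2") auto
    then show ?thesis using M(1) by blast
  qed
  have meas: "(\<lambda>x. \<omega> (t, x)) \<in> borel_measurable borel" for t
    by (intro borel_measurable_continuous_onI continuous_on_compose2[OF \<omega>] continuous_intros) auto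
  have int: "integrable lborel (\<lambda>x. a x * \<omega> (t, x))"
    if "t \<ge> 0" "integrable lborel a" for a t
  proof -
    obtain M where M: "M > 0" "\<forall>s\<in>{0..t}. \<forall>x. \<bar>\<omega> (s, x)\<bar> \<le> M" using bdd by blast
    have "integrable lborel (\<lambda>x. M * a x)" using that by simp
    then show ?thesis
    proof (rule Bochner_Integration.integrable_bound)
      show "(\<lambda>x. a x * \<omega> (t, x)) \<in> borel_measurable lborel"
        using meas borel_measurable_integrable[OF that(2)] by simp
      show "AE x in lborel. norm (a x * \<omega> (t, x)) \<le> norm (M * a x)"
        using M that(1) by (auto simp: abs_mult mult.commute[of M] intro!: mult_left_mono)
    qed
  qed
  show "t \<ge> 0 \<Longrightarrow> integrable lborel (\<lambda>x. w t x * \<omega> (t, x))"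
    using int C_Lr_1_integrable[OF w] by blast
  show "continuous_on {0..} (\<lambda>t. LINT x|lborel. w t x * \<omega> (t, x))"
    unfolding continuous_on_def
  proof (intro ballI tendstoI)
    fix s e :: real assume "s \<in> {0..}" and e: "e > 0"
    then have s: "s \<ge> 0" by simp
    obtain M where M: "M > 0" "\<forall>t\<in>{0..s+1}. \<forall>x. \<bar>\<omega> (t, x)\<bar> \<le> M" using bdd by blast
    define N where "N = (LINT x|lborel. \<bar>w s x\<bar>)"
    have N: "N \<ge> 0" by (simp add: N_def)
    define \<delta> where "\<delta> = e / (2 * (N + 1))"
    have \<delta>: "\<delta> > 0" using e N by (simp add: \<delta>_def)
    \<comment> \<open>The radius s + 3 covers the supports of the weight at all times up to s +
      1.\<close>
    have "uniformly_continuous_on ({0..s+1} \<times> cball (0::real^'n) (s + 3)) \<omega>"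
      by (intro compact_uniformly_continuous continuous_on_subset[OF \<omega>] compact_Times) auto
    then obtain d where d: "d > 0"
      "\<And>y z. y \<in> {0..s+1} \<times> cball (0::real^'n) (s + 3) \<Longrightarrow> z \<in> {0..s+1} \<times> cball (0::real^'n) (s + 3) \<Longrightarrow>
        dist z y < d \<Longrightarrow> dist (\<omega> z) (\<omega> y) < \<delta>"
      unfolding uniformly_continuous_on_def using \<delta> by metis
    have "\<forall>\<^sub>F t in at s within {0..}. (LINT x|lborel. \<bar>w t x - w s x\<bar> powr 1) < e / (2 * M)"
      using order_tendstoD(2)[OF C_Lr_D(3)[OF w s]] e M by simp
    moreover have "\<forall>\<^sub>F t in at s within {0..}. t \<ge> 0"
      by (simp add: eventually_at_filter)
    moreover have "\<forall>\<^sub>F t in at s within {0..}. dist t s < min d 1"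
      unfolding eventually_at using d(1) by (intro exI[of _ "min d 1"]) auto
    ultimately show "\<forall>\<^sub>F t in at s within {0..}.
        dist (LINT x|lborel. w t x * \<omega> (t, x)) (LINT x|lborel. w s x * \<omega> (s, x)) < e"
    proof eventually_elim
      case (elim t)
      have t: "t \<in> {0..s+1}" using elim by (auto simp: dist_real_def)
      have iw: "integrable lborel (w t)" "integrable lborel (w s)"
        using C_Lr_1_integrable[OF w] s elim by auto
      have \<omega>d: "\<bar>\<omega> (t, x) - \<omega> (s, x)\<bar> \<le> \<delta>" for x
      proof (cases "norm x \<le> s + 3")
        case True
        then have "dist (\<omega> (t, x)) (\<omega> (s, x)) < \<delta>"
          using t s elim by (intro d(2)) (auto simp: dist_Pair_Pair)
        then show ?thesis by (simp add: dist_real_def)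
      next
        case False
        then show ?thesis using supp[of t x] supp[of s x] t s \<delta> by auto
      qed
      have "(LINT x|lborel. w t x * \<omega> (t, x)) - (LINT x|lborel. w s x * \<omega> (s, x))
          = (LINT x|lborel. w t x * \<omega> (t, x) - w s x * \<omega> (s, x))"
        using int iw s elim by simp
      also have "\<bar>\<dots>\<bar> \<le> (LINT x|lborel. M * \<bar>w t x - w s x\<bar> + \<delta> * \<bar>w s x\<bar>)"
      proof (rule integral_abs_bound_integral)
        show "integrable lborel (\<lambda>x. w t x * \<omega> (t, x) - w s x * \<omega> (s, x))"
          using int iw s elim by simp
        show "integrable lborel (\<lambda>x. M * \<bar>w t x - w s x\<bar> + \<delta> * \<bar>w s x\<bar>)"
          using iw by simp
        fix x
        have "w t x * \<omega> (t, x) - w s x * \<omega> (s, x)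
            = \<omega> (t, x) * (w t x - w s x) + (\<omega> (t, x) - \<omega> (s, x)) * w s x"
          by (simp add: algebra_simps)
        also have "\<bar>\<dots>\<bar> \<le> \<bar>\<omega> (t, x)\<bar> * \<bar>w t x - w s x\<bar> + \<bar>\<omega> (t, x) - \<omega> (s, x)\<bar> * \<bar>w s x\<bar>"
          unfolding abs_mult[symmetric] by (rule abs_triangle_ineq)
        also have "\<dots> \<le> M * \<bar>w t x - w s x\<bar> + \<delta> * \<bar>w s x\<bar>"
          using M t \<omega>d by (intro add_mono mult_right_mono) auto
        finally show "\<bar>w t x * \<omega> (t, x) - w s x * \<omega> (s, x)\<bar> \<le> M * \<bar>w t x - w s x\<bar> + \<delta> * \<bar>w s x\<bar>" .
      qed
      also have "\<dots> = M * (LINT x|lborel. \<bar>w t x - w s x\<bar>) + \<delta> * N"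
        using iw by (simp add: N_def)
      also have "\<delta> * N \<le> e / 2"
        using N e by (simp add: \<delta>_def field_simps)
      also have "M * (LINT x|lborel. \<bar>w t x - w s x\<bar>) < e / 2"
        using elim(1) M(1) by (simp add: field_simps)
      finally show ?case by (simp add: dist_real_def)
    qed
  qed
qed

lemma set_integral_cut:
  fixes g :: "real \<Rightarrow> real"
  assumes "continuous_on {0..} g" "\<And>t. t \<ge> S \<Longrightarrow> g t = 0"
  shows "(LINT t:{0..}|lborel. g t) = integral {0..S} g"
proof -
  have "(LINT t:{0..}|lborel. g t) = (LINT t:{0..S}|lborel. g t)"
    unfolding set_lebesgue_integral_def
    by (rule Bochner_Integration.integral_cong) (use assms(2) in \<open>auto simp: indicator_def\<close>)
  also have "\<dots> = integral {0..S} g"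
    by (intro set_borel_integral_eq_integral borel_integrable_atLeastAtMost'
        continuous_on_subset[OF assms(1)]) auto
  finally show ?thesis .
qed

text \<open>The substitution t = \<delta> s gives the integral of g(\<delta> s) k(s) over [0,1],
  which depends continuously on \<delta> \<ge> 0 and can be evaluated at \<delta> = 0. Kernels of
  this kind extract values at t = 0 from weak identities.\<close>

lemma tendsto_rescaled_integral:
  fixes g k :: "real \<Rightarrow> real"
  assumes "continuous_on {0..} g" "continuous_on {0..1} k"
  shows "((\<lambda>\<delta>. integral {0..\<delta>} (\<lambda>t. g t * k (t / \<delta>) / \<delta>)) \<longlongrightarrow> g 0 * integral {0..1} k) (at_right 0)"
proof -
  have "continuous_on {0..} (\<lambda>\<delta>. integral (cbox 0 1) (\<lambda>s. g (\<delta> * s) * k s))"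
    by (rule integral_continuous_on_param)
      (auto simp: case_prod_beta intro!: continuous_intros continuous_on_compose2[OF assms(1)]
        continuous_on_compose2[OF assms(2)])
  then have "((\<lambda>\<delta>. integral {0..1} (\<lambda>s. g (\<delta> * s) * k s)) \<longlongrightarrow> integral {0..1} (\<lambda>s. g (0 * s) * k s)) (at 0 within {0..})"
    unfolding continuous_on_def by (simp only: cbox_interval) (erule bspec, simp)
  then have "((\<lambda>\<delta>. integral {0..1} (\<lambda>s. g (\<delta> * s) * k s)) \<longlongrightarrow> g 0 * integral {0..1} k) (at_right 0)"
    by (auto intro: tendsto_within_subset)
  then show ?thesis
  proof (rule Lim_transform_eventually)
    have "integral {0..1} (\<lambda>s. g (\<delta> * s) * k s) = integral {0..\<delta>} (\<lambda>t. g t * k (t / \<delta>) / \<delta>)"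
      if "\<delta> > 0" for \<delta>
    proof -
      have "integral ((\<lambda>x. x / \<delta>) ` {0..\<delta>}) (\<lambda>x. g (\<delta> * x) * k (\<delta> * x / \<delta>) / \<delta>)
          = (1 / \<bar>\<delta>\<bar>) *\<^sub>R integral {0..\<delta>} (\<lambda>t. g t * k (t / \<delta>) / \<delta>)"
        using integral_stretch_real[of \<delta> 0 \<delta> "\<lambda>t. g t * k (t / \<delta>) / \<delta>"] that by simp
      moreover have "(\<lambda>x. x / \<delta>) ` {0..\<delta>} = {0..1}"
        using that image_divide_atLeastAtMost[of \<delta> 0 \<delta>] by simp
      ultimately show ?thesis using that by (simp add: field_simps)
    qed
    then show "\<forall>\<^sub>F \<delta> in at_right 0. integral {0..1} (\<lambda>s. g (\<delta> * s) * k s) = integral {0..\<delta>} (\<lambda>t. g t * k (t / \<delta>) / \<delta>)"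
      by (auto simp: eventually_at_right_field intro!: exI[of _ 1])
  qed
qed

section \<open>Plane waves cut off near the light cone\<close>

text \<open>The endpoint t = S is included: the function is known only to the right of it, but the
  one-sided derivative already determines the derivative.\<close>

lemma dderiv_eq_0_from:
  fixes h :: "real \<Rightarrow> real"
  assumes "smooth_fun h" "\<And>t. t \<ge> S \<Longrightarrow> h t = 0" "t \<ge> S"
  shows "dderiv 1 h t = 0"
proof -
  have "(h has_real_derivative dderiv 1 h t) (at t within {t..})"
    using smooth_fun_real_deriv[OF assms(1)] by (rule DERIV_subset) simp
  moreover have "(h has_real_derivative 0) (at t within {t..})"
    by (rule has_field_derivative_transform_within[where d=1 and f="\<lambda>_. 0"]) (use assms in auto)
  ultimately show ?thesis
    using vector_derivative_unique_within[of t "{t..}" h "dderiv 1 h t" 0]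
    by (simp add: has_real_derivative_iff_has_vector_derivative at_within_Ici_at_right)
qed

lemma smooth_fun_real_id: "smooth_fun (\<lambda>t::real. t)"
  by (intro smooth_fun_bounded_linear bounded_linear_ident)

text \<open>Serves |x|^2, the smooth substitute for the norm in the cutoff. Its derivative is linear
  in z, which ends the recursion after one step.\<close>

lemma smooth_fun_inner_self:
  fixes L :: "'a::euclidean_space \<Rightarrow> 'b::euclidean_space"
  assumes L: "bounded_linear L"
  shows "smooth_fun (\<lambda>z. L z \<bullet> L z)"
  unfolding smooth_fun_def
proof
  fix k
  show "Ck k (\<lambda>z. L z \<bullet> L z)"
  proof (cases k)
    case 0
    then show ?thesis using L by (simp add: continuous_on_inner linear_continuous_on)
  next
    case (Suc m)
    show ?thesis unfolding Suc
    proof (rule Ck_SucI)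
      show "((\<lambda>z. L z \<bullet> L z) has_derivative (\<lambda>e. L z \<bullet> L e + L e \<bullet> L z)) (at z)" for z
        by (intro has_derivative_inner bounded_linear_imp_has_derivative L)
      show "Ck m (\<lambda>z. L z \<bullet> L e + L e \<bullet> L z)" for e
        by (intro Ck_bounded_linear bounded_linear_add
            bounded_linear_compose[OF bounded_linear_inner_left L]
            bounded_linear_compose[OF bounded_linear_inner_right L])
    qed
  qed
qed

text \<open>The plane wave $e^{x_i}$ satisfies $\Delta e^{x_i} = e^{x_i}$; the two cutoffs equal one near the
  forward cone \<open>t \<ge> 0, norm x \<le> t + 1\<close> and make its products with functions of \<open>t\<close> test functions.\<close>

definition cone_weight :: "'n \<Rightarrow> real \<times> (real^'n) \<Rightarrow> real" where
  "cone_weight i z = exp (snd z $ i) * (plateau (snd z \<bullet> snd z - (fst z + 1)\<^sup>2) * plateau (- fst z))"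

text \<open>Both cutoffs are one on this set. Its openness makes the derivatives of the cut-off
  plane wave agree there with those of the plane wave.\<close>

definition cone_nbhd :: "(real \<times> (real^'n)) set" where
  "cone_nbhd = {z. snd z \<bullet> snd z - (fst z + 1)\<^sup>2 < 1/2 \<and> - fst z < 1/2}"

lemma open_cone_nbhd: "open (cone_nbhd :: (real \<times> (real^'n)) set)"
  unfolding cone_nbhd_def Collect_conj_eq
  by (intro open_Int open_Collect_less continuous_intros)

lemma cone_nbhd_mem:
  assumes "t \<ge> 0" "norm x \<le> t + 1"
  shows "(t, x) \<in> cone_nbhd"
proof -
  have "x \<bullet> x \<le> (t + 1)\<^sup>2"
    using assms by (simp add: dot_square_norm power_mono)
  then show ?thesis using assms by (simp add: cone_nbhd_def)
qed

lemma cone_weight_on_nbhd: "z \<in> cone_nbhd \<Longrightarrow> cone_weight i z = exp (snd z $ i)"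
  by (simp add: cone_nbhd_def cone_weight_def plateau_eq_1)

lemma cone_weight_nonneg: "0 \<le> cone_weight i z"
  by (simp add: cone_weight_def plateau_nonneg)

lemma cone_weight_le: "cone_weight i z \<le> exp (snd z $ i)"
proof -
  have "plateau a * plateau b \<le> 1" for a b
    using mult_mono[of "plateau a" 1 "plateau b" 1] plateau_le_1 plateau_nonneg by simp
  then show ?thesis unfolding cone_weight_def using mult_left_mono[of _ 1 "exp (snd z $ i)"] by simp
qed

text \<open>The first cutoff alone would also keep the backward cone, since (t + 1)^2 grows again
  for t < -1. The second cutoff removes those times, and for t > -1 one has (t + 1)^2 + 1 \<le> (t +
  2)^2.\<close>

lemma cone_weight_nonzero:
  assumes "cone_weight i (t, x) \<noteq> 0"
  shows "- 1 < t" "norm x \<le> t + 2"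
proof -
  have nz: "plateau (x \<bullet> x - (t + 1)\<^sup>2) \<noteq> 0" "plateau (- t) \<noteq> 0"
    using assms by (auto simp: cone_weight_def)
  then show t: "- 1 < t" using plateau_eq_0[of "- t"] by force
  have "x \<bullet> x < (t + 1)\<^sup>2 + 1" using nz plateau_eq_0[of "x \<bullet> x - (t + 1)\<^sup>2"] by force
  also have "\<dots> \<le> (t + 2)\<^sup>2" using t by (simp add: power2_eq_square algebra_simps)
  finally have "(norm x)\<^sup>2 \<le> (t + 2)\<^sup>2" by (simp add: dot_square_norm)
  then show "norm x \<le> t + 2" by (rule power2_le_imp_le) (use t in simp)
qed

lemma smooth_fun_exp_component: "smooth_fun (\<lambda>z :: real \<times> (real^'n). exp (snd z $ i))"
  by (intro smooth_fun_compose[OF smooth_fun_exp] smooth_fun_bounded_linear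
      bounded_linear_compose[OF bounded_linear_vec_nth bounded_linear_snd])

lemma smooth_fun_fst: "smooth_fun (fst :: real \<times> (real^'n) \<Rightarrow> real)"
  by (intro smooth_fun_bounded_linear bounded_linear_fst)

lemma smooth_fun_cone_weight: "smooth_fun (cone_weight (i::'n::finite))"
proof -
  have "smooth_fun (\<lambda>z :: real \<times> (real^'n).
      exp (snd z $ i) * (plateau (snd z \<bullet> snd z - (fst z + 1) * (fst z + 1)) * plateau (- fst z)))"
    by (intro smooth_fun_mult smooth_fun_exp_component smooth_fun_compose[OF smooth_fun_plateau]
        smooth_fun_diff smooth_fun_minus smooth_fun_add smooth_fun_const smooth_fun_fst
        smooth_fun_inner_self bounded_linear_snd)
  then show ?thesis by (simp add: cone_weight_def[abs_def] power2_eq_square)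
qed

lemma smooth_fun_time_weight:
  "smooth_fun \<rho> \<Longrightarrow> smooth_fun (\<lambda>z. \<rho> (fst z) * cone_weight (i::'n::finite) z)"
  by (rule smooth_fun_mult[OF smooth_fun_compose[OF _ smooth_fun_fst] smooth_fun_cone_weight])

lemma test_fun_time_weight:
  assumes "smooth_fun \<rho>" "\<And>t. t \<ge> S \<Longrightarrow> \<rho> t = 0"
  shows "test_fun (\<lambda>z. \<rho> (fst z) * cone_weight (i::'n::finite) z)"
  unfolding test_fun_def
proof
  let ?\<Psi> = "\<lambda>z. \<rho> (fst z) * cone_weight i z"
  show "smooth_fun ?\<Psi>" by (rule smooth_fun_time_weight[OF assms(1)])
  \<comment> \<open>The future is bounded by \<rho>, the past only by the cone weight, since \<rho>
    need not vanish for negative times.\<close>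
  have "z \<in> {-1..S} \<times> cball 0 (S + 2)" if "?\<Psi> z \<noteq> 0" for z
  proof -
    have "cone_weight i (fst z, snd z) \<noteq> 0" "fst z < S"
      using that assms(2)[of "fst z"] by force+
    then show ?thesis using cone_weight_nonzero[of i "fst z" "snd z"] by (auto simp: mem_Times_iff)
  qed
  then have "{z. ?\<Psi> z \<noteq> 0} \<subseteq> {-1..S} \<times> cball 0 (S + 2)" by blast
  moreover have "bounded ({-1..S} \<times> cball (0::real^'n) (S + 2))"
    by (intro bounded_Times) auto
  ultimately show "compact (closure {z. ?\<Psi> z \<noteq> 0})"
    using bounded_subset compact_closure by blast
qed

lemma plane_wave_has_derivative:
  fixes i :: "'n::finite"
  assumes "smooth_fun \<rho>"
  shows "((\<lambda>z. \<rho> (fst z) * exp (snd z $ i)) has_derivative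
    (\<lambda>h. dderiv 1 \<rho> (fst z) * fst h * exp (snd z $ i) + \<rho> (fst z) * exp (snd z $ i) * snd h $ i)) (at z)"
proof -
  have d: "(\<rho> has_derivative (*) (dderiv 1 \<rho> (fst z))) (at (fst z))"
    using smooth_fun_real_deriv[OF assms, of "fst z"] by (simp only: has_field_derivative_def)
  have 1: "((\<lambda>z. \<rho> (fst z)) has_derivative (\<lambda>h. dderiv 1 \<rho> (fst z) * fst h)) (at z)"
    using has_derivative_compose[OF bounded_linear_imp_has_derivative[OF bounded_linear_fst] d] .
  have 2: "((\<lambda>z. exp (snd z $ i)) has_derivative (\<lambda>h. exp (snd z $ i) * (snd h $ i))) (at z)"
  proof -
    have "((\<lambda>z :: real \<times> (real^'n). snd z $ i) has_derivative (\<lambda>h. snd h $ i)) (at z)"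
      by (rule bounded_linear_imp_has_derivative,
          rule bounded_linear_compose[OF bounded_linear_vec_nth bounded_linear_snd])
    from has_derivative_exp[OF this] show ?thesis by (simp only: mult.commute)
  qed
  have eq: "(\<lambda>h. \<rho> (fst z) * (exp (snd z $ i) * snd h $ i) + dderiv 1 \<rho> (fst z) * fst h * exp (snd z $ i))
     = (\<lambda>h. dderiv 1 \<rho> (fst z) * fst h * exp (snd z $ i) + \<rho> (fst z) * exp (snd z $ i) * snd h $ i)"
    by (rule ext) (simp only: mult.assoc add.commute)
  show ?thesis using has_derivative_mult[OF 1 2] unfolding eq .
qed

text \<open>F is any function that agrees with the plane wave on the neighbourhood. The result has
  the same form with another time factor when e is a pure time or space direction, so the lemma can
  be applied to first derivatives again.\<close>

lemma dderiv_time_weight: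
  fixes i :: "'n::finite"
  assumes "smooth_fun \<rho>" "z \<in> cone_nbhd"
    and "\<And>y. y \<in> cone_nbhd \<Longrightarrow> F y = \<rho> (fst y) * exp (snd y $ i)"
  shows "dderiv e F z = dderiv 1 \<rho> (fst z) * fst e * exp (snd z $ i) + \<rho> (fst z) * exp (snd z $ i) * snd e $ i"
proof -
  have "dderiv e F z = dderiv e (\<lambda>y. \<rho> (fst y) * exp (snd y $ i)) z"
    by (rule dderiv_cong_open[OF open_cone_nbhd assms(2,3)])
  also note dderiv_eq[OF plane_wave_has_derivative[OF assms(1), of i z], of e]
  finally show ?thesis .
qed

lemma smooth_fun_real_dderiv:
  "smooth_fun (h :: real \<Rightarrow> real) \<Longrightarrow> smooth_fun (dderiv 1 h)"
  by (rule smooth_fun_dderiv) auto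

lemma dt_time_weight:
  fixes i :: "'n::finite"
  assumes "smooth_fun \<rho>" "z \<in> cone_nbhd"
  shows "dt (\<lambda>z. \<rho> (fst z) * cone_weight i z) z = dderiv 1 \<rho> (fst z) * exp (snd z $ i)"
    and "dt (dt (\<lambda>z. \<rho> (fst z) * cone_weight i z)) z = dderiv 1 (dderiv 1 \<rho>) (fst z) * exp (snd z $ i)"
proof -
  have *: "dt (\<lambda>z. \<rho> (fst z) * cone_weight i z) z = dderiv 1 \<rho> (fst z) * exp (snd z $ i)"
    if "z \<in> cone_nbhd" for z
    unfolding dt_def using dderiv_time_weight[OF assms(1) that, where F="\<lambda>z. \<rho> (fst z) * cone_weight i z" and i=i]
    by (simp add: cone_weight_on_nbhd)
  then show "dt (\<lambda>z. \<rho> (fst z) * cone_weight i z) z = dderiv 1 \<rho> (fst z) * exp (snd z $ i)"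
    using assms(2) .
  show "dt (dt (\<lambda>z. \<rho> (fst z) * cone_weight i z)) z = dderiv 1 (dderiv 1 \<rho>) (fst z) * exp (snd z $ i)"
    using dderiv_time_weight[OF smooth_fun_real_dderiv[OF assms(1)] assms(2) *, where e="(1, 0)"]
    unfolding dt_def[of "dt _"] by simp
qed

lemma axis_Basis: "axis i (1::real) \<in> Basis"
  by (auto simp: Basis_vec_def)

text \<open>This sum is the coefficient in \<Delta> e^{x_i} = e^{x_i}.\<close>

lemma sum_Basis_component_square: "(\<Sum>b\<in>(Basis :: (real^'n) set). b $ i * b $ i) = 1"
proof -
  have "(\<Sum>b\<in>(Basis :: (real^'n) set). b $ i * b $ i)
      = (\<Sum>b\<in>(Basis :: (real^'n) set). if b = axis i 1 then 1 else 0)"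
  proof (rule sum.cong)
    fix b :: "real^'n" assume b: "b \<in> Basis"
    have "b $ i = b \<bullet> axis i 1" by (simp add: inner_axis)
    then show "b $ i * b $ i = (if b = axis i 1 then 1 else 0)"
      using inner_Basis[OF b, of "axis i 1"] by (simp add: axis_Basis)
  qed simp
  also have "\<dots> = 1" by (simp add: axis_Basis)
  finally show ?thesis .
qed

lemma laplace_x_time_weight:
  fixes i :: "'n::finite"
  assumes "smooth_fun \<rho>" "z \<in> cone_nbhd"
  shows "laplace_x (\<lambda>z. \<rho> (fst z) * cone_weight i z) z = \<rho> (fst z) * exp (snd z $ i)"
proof -
  let ?\<Psi> = "\<lambda>z. \<rho> (fst z) * cone_weight i z"
  have 1: "dderiv (0, b) ?\<Psi> z = \<rho> (fst z) * b $ i * exp (snd z $ i)" if "z \<in> cone_nbhd" for z b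
    using dderiv_time_weight[OF assms(1) that, where F="?\<Psi>" and i=i] by (simp add: cone_weight_on_nbhd)
  \<comment> \<open>The constant \<open>b $ i\<close> is absorbed into the time factor so that
    \<open>dderiv_time_weight\<close> also yields the second derivative.\<close>
  have sm: "smooth_fun (\<lambda>t. \<rho> t * b $ i)" for b :: "real^'n"
    by (intro smooth_fun_mult assms(1) smooth_fun_const)
  have "dderiv (0, b) (dderiv (0, b) ?\<Psi>) z = \<rho> (fst z) * exp (snd z $ i) * (b $ i * b $ i)" for b
    using dderiv_time_weight[OF sm[of b] assms(2) 1[of _ b], where e="(0, b)"] by (simp add: mult_ac)
  then show ?thesis
    unfolding laplace_x_def by (simp add: sum_distrib_left[symmetric] sum_Basis_component_square)
qed

section \<open>Reduction to equations in time\<close>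

text \<open>The cutoffs stay inside the weight, so the integral makes sense at t \<ge> 0 for every w
  in L^1; for w supported in the cone it is the integral of w e^{x_i}.\<close>

definition weighted_mean :: "'n \<Rightarrow> (real \<Rightarrow> real^'n \<Rightarrow> real) \<Rightarrow> real \<Rightarrow> real" where
  "weighted_mean i w t = (LINT x|lborel. w t x * cone_weight i (t, x))"

lemma
  fixes w :: "real \<Rightarrow> real^'n \<Rightarrow> real"
  assumes "C_Lr 1 w"
  shows integrable_cone_weight: "t \<ge> 0 \<Longrightarrow> integrable lborel (\<lambda>x. w t x * cone_weight i (t, x))"
    and continuous_weighted_mean: "continuous_on {0..} (weighted_mean i w)"
proof -
  have supp: "cone_weight i (t, x) = 0" if "norm x > t + 2" for t and x :: "real^'n"
    using cone_weight_nonzero(2)[of i t x] that by force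
  note * = continuous_weighted_integral[OF assms smooth_fun_continuous[OF smooth_fun_cone_weight], of i, OF supp]
  show "t \<ge> 0 \<Longrightarrow> integrable lborel (\<lambda>x. w t x * cone_weight i (t, x))"
    using *(1) .
  show "continuous_on {0..} (weighted_mean i w)"
    using *(2) unfolding weighted_mean_def[abs_def] .
qed

lemma set_integral_cut_cong:
  fixes g :: "real \<Rightarrow> real"
  assumes "continuous_on {0..} g" "\<And>t. t \<ge> S \<Longrightarrow> g t = 0" "\<And>t. t \<ge> 0 \<Longrightarrow> h t = g t"
  shows "(LINT t:{0..}|lborel. h t) = integral {0..S} g"
proof -
  have "(LINT t:{0..}|lborel. h t) = (LINT t:{0..}|lborel. g t)"
    by (rule set_lebesgue_integral_cong) (use assms(3) in auto)
  with set_integral_cut[OF assms(1,2)] show ?thesis by simp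
qed

lemma cone_integral_eq:
  fixes w :: "real \<Rightarrow> real^'n \<Rightarrow> real"
  assumes w: "C_Lr 1 w" and supp: "AE x in lborel. norm x > t + 1 \<longrightarrow> w t x = 0" and t: "t \<ge> 0"
    and F: "continuous_on UNIV F"
    and eq: "\<And>z. z \<in> cone_nbhd \<Longrightarrow> fst z = t \<Longrightarrow> F z = c * exp (snd z $ i)"
  shows "(LINT x|lborel. w t x * F (t, x)) = c * weighted_mean i w t"
proof -
  have m: "w t \<in> borel_measurable borel" using C_Lr_D(1)[OF w t] .
  have mF: "(\<lambda>x. F (t, x)) \<in> borel_measurable borel" if "continuous_on UNIV F" for F :: "real \<times> (real^'n) \<Rightarrow> real"
    by (intro borel_measurable_continuous_onI continuous_on_compose2[OF that] continuous_intros) auto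
  have "(LINT x|lborel. w t x * F (t, x)) = (LINT x|lborel. c * (w t x * cone_weight i (t, x)))"
  proof (rule integral_cong_AE)
    show "(\<lambda>x. w t x * F (t, x)) \<in> borel_measurable lborel"
      using m mF[OF F] by simp
    show "(\<lambda>x. c * (w t x * cone_weight i (t, x))) \<in> borel_measurable lborel"
      using m mF[OF smooth_fun_continuous[OF smooth_fun_cone_weight]] by simp
    show "AE x in lborel. w t x * F (t, x) = c * (w t x * cone_weight i (t, x))"
      using supp
    proof eventually_elim
      case (elim x)
      show ?case
      proof (cases "norm x \<le> t + 1")
        case True
        then have "(t, x) \<in> cone_nbhd" using t by (rule cone_nbhd_mem[rotated])
        then show ?thesis using eq[of "(t, x)"] cone_weight_on_nbhd[of "(t, x)" i] by simp
      qed (use elim in auto)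
    qed
  qed
  then show ?thesis by (simp add: weighted_mean_def)
qed

lemma smooth_fun_laplace_x: "smooth_fun F \<Longrightarrow> continuous_on UNIV (laplace_x F)"
  unfolding laplace_x_def
  by (intro continuous_on_sum smooth_fun_continuous smooth_fun_dderiv) (auto simp: Basis_prod_def)

lemma smooth_fun_dt: "smooth_fun F \<Longrightarrow> smooth_fun (dt F)"
  unfolding dt_def by (intro smooth_fun_dderiv) (auto simp: Basis_prod_def)

text \<open>Since e^{x_i} is reproduced by the Laplacian, the weighted mean U of w solves U'' - U =
  F in the weak sense, with F the weighted mean of the source. The support property of w removes the
  derivatives of the cutoffs.\<close>

lemma weak_wave_weighted_mean:
  fixes w :: "real \<Rightarrow> real^'n \<Rightarrow> real"
  assumes ww: "weak_wave \<epsilon> f g F w" and w: "C_Lr 1 w" and F: "C_Lr 1 F"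
    and supp: "\<And>t. t \<ge> 0 \<Longrightarrow> AE x in lborel. norm x > t + 1 \<longrightarrow> w t x = 0"
    and data: "\<And>x. norm x > 1 \<Longrightarrow> f x = 0 \<and> g x = 0"
    and \<rho>: "smooth_fun \<rho>" "\<And>t. t \<ge> S \<Longrightarrow> \<rho> t = 0"
  shows "integral {0..S} (\<lambda>t. (dderiv 1 (dderiv 1 \<rho>) t - \<rho> t) * weighted_mean i w t)
    = integral {0..S} (\<lambda>t. \<rho> t * weighted_mean i F t)
      + \<epsilon> * (\<rho> 0 * (LINT x|lborel. g x * exp (x $ i)))
      - \<epsilon> * (dderiv 1 \<rho> 0 * (LINT x|lborel. f x * exp (x $ i)))"
proof -
  define \<Psi> where "\<Psi> = (\<lambda>z. \<rho> (fst z) * cone_weight i z)"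
  have sm: "smooth_fun \<Psi>" unfolding \<Psi>_def by (rule smooth_fun_time_weight[OF \<rho>(1)])
  have sm1: "smooth_fun (dderiv 1 \<rho>)" by (rule smooth_fun_real_dderiv[OF \<rho>(1)])
  have sm2: "smooth_fun (dderiv 1 (dderiv 1 \<rho>))" by (rule smooth_fun_real_dderiv[OF sm1])
  have z1: "dderiv 1 \<rho> t = 0" if "t \<ge> S" for t
    using dderiv_eq_0_from[OF \<rho> that] .
  have z2: "dderiv 1 (dderiv 1 \<rho>) t = 0" if "t \<ge> S" for t
    using dderiv_eq_0_from[OF sm1 z1 that] .
  have L: "st_int (\<lambda>t x. w t x * (dt (dt \<Psi>) (t, x) - laplace_x \<Psi> (t, x)))
      = integral {0..S} (\<lambda>t. (dderiv 1 (dderiv 1 \<rho>) t - \<rho> t) * weighted_mean i w t)"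
    unfolding st_int_def
  proof (rule set_integral_cut_cong)
    show "continuous_on {0..} (\<lambda>t. (dderiv 1 (dderiv 1 \<rho>) t - \<rho> t) * weighted_mean i w t)"
      by (intro continuous_intros smooth_fun_continuous sm2 \<rho>(1) continuous_weighted_mean[OF w])
    fix t :: real assume t: "t \<ge> 0"
    have "continuous_on UNIV (\<lambda>z. dt (dt \<Psi>) z - laplace_x \<Psi> z)"
      by (intro continuous_on_diff smooth_fun_continuous smooth_fun_dt smooth_fun_laplace_x sm)
    then show "(LINT x|lborel. w t x * (dt (dt \<Psi>) (t, x) - laplace_x \<Psi> (t, x)))
        = (dderiv 1 (dderiv 1 \<rho>) t - \<rho> t) * weighted_mean i w t"
      by (rule cone_integral_eq[OF w supp[OF t] t])
        (simp add: \<Psi>_def dt_time_weight[OF \<rho>(1)] laplace_x_time_weight[OF \<rho>(1)] left_diff_distrib)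
  qed (simp add: \<rho>(2) z2)
  \<comment> \<open>The source multiplies the undifferentiated test function, cutoffs included,
    which is already the weighted mean of F; its support does not enter.\<close>
  have R1: "st_int (\<lambda>t x. F t x * \<Psi> (t, x)) = integral {0..S} (\<lambda>t. \<rho> t * weighted_mean i F t)"
    unfolding st_int_def
  proof (rule set_integral_cut_cong)
    show "continuous_on {0..} (\<lambda>t. \<rho> t * weighted_mean i F t)"
      by (intro continuous_intros smooth_fun_continuous \<rho>(1) continuous_weighted_mean[OF F])
    show "(LINT x|lborel. F t x * \<Psi> (t, x)) = \<rho> t * weighted_mean i F t" for t
      by (simp add: \<Psi>_def weighted_mean_def mult.left_commute[of _ "\<rho> t"])
  qed (simp add: \<rho>(2))
  have initial: "(LINT x|lborel. h x * c (0, x)) = d * (LINT x|lborel. h x * exp (x $ i))"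
    if "\<And>x. norm x > 1 \<Longrightarrow> h x = 0"
       "\<And>z. z \<in> cone_nbhd \<Longrightarrow> fst z = 0 \<Longrightarrow> c z = d * exp (snd z $ i)" for h d and c :: "real \<times> (real^'n) \<Rightarrow> real"
  proof -
    have "(LINT x|lborel. h x * c (0, x)) = (LINT x|lborel. d * (h x * exp (x $ i)))"
    proof (rule Bochner_Integration.integral_cong)
      fix x
      show "h x * c (0, x) = d * (h x * exp (x $ i))"
      proof (cases "norm x \<le> 1")
        case True
        then show ?thesis using that(2)[OF cone_nbhd_mem[of 0 x]] by simp
      qed (use that(1) in auto)
    qed simp
    then show ?thesis by simp
  qed
  have R2: "(LINT x|lborel. g x * \<Psi> (0, x)) = \<rho> 0 * (LINT x|lborel. g x * exp (x $ i))"
    by (rule initial) (use data in \<open>simp_all add: \<Psi>_def cone_weight_on_nbhd\<close>)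
  have R3: "(LINT x|lborel. f x * dt \<Psi> (0, x)) = dderiv 1 \<rho> 0 * (LINT x|lborel. f x * exp (x $ i))"
    by (rule initial) (use data in \<open>simp_all add: \<Psi>_def dt_time_weight[OF \<rho>(1)]\<close>)
  have tf: "test_fun \<Psi>" unfolding \<Psi>_def by (rule test_fun_time_weight[OF \<rho>])
  from ww[unfolded weak_wave_def, rule_format, OF tf] show ?thesis
    unfolding L R1 R2 R3 .
qed

text \<open>The weak form of U' = A for the weighted means U and A of w and w1, so far only against
  \<rho> vanishing for t \<le> 0.\<close>

lemma time_deriv_weighted_mean:
  fixes w w1 :: "real \<Rightarrow> real^'n \<Rightarrow> real"
  assumes td: "is_time_deriv w w1" and w: "C_Lr 1 w" and w1: "C_Lr 1 w1"
    and supp: "\<And>t. t \<ge> 0 \<Longrightarrow> AE x in lborel. norm x > t + 1 \<longrightarrow> w t x = 0"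
    and \<rho>: "smooth_fun \<rho>" "\<And>t. t \<ge> S \<Longrightarrow> \<rho> t = 0" "\<And>t. t \<le> 0 \<Longrightarrow> \<rho> t = 0"
  shows "integral {0..S} (\<lambda>t. dderiv 1 \<rho> t * weighted_mean i w t)
    = - integral {0..S} (\<lambda>t. \<rho> t * weighted_mean i w1 t)"
proof -
  define \<Psi> where "\<Psi> = (\<lambda>z. \<rho> (fst z) * cone_weight i z)"
  have sm: "smooth_fun \<Psi>" unfolding \<Psi>_def by (rule smooth_fun_time_weight[OF \<rho>(1)])
  have sm1: "smooth_fun (dderiv 1 \<rho>)" by (rule smooth_fun_real_dderiv[OF \<rho>(1)])
  have L: "st_int (\<lambda>t x. w t x * dt \<Psi> (t, x)) = integral {0..S} (\<lambda>t. dderiv 1 \<rho> t * weighted_mean i w t)"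
    unfolding st_int_def
  proof (rule set_integral_cut_cong)
    show "continuous_on {0..} (\<lambda>t. dderiv 1 \<rho> t * weighted_mean i w t)"
      by (intro continuous_intros smooth_fun_continuous sm1 continuous_weighted_mean[OF w])
    show "dderiv 1 \<rho> t * weighted_mean i w t = 0" if "t \<ge> S" for t
      using dderiv_eq_0_from[OF \<rho>(1,2) that] by simp
    fix t :: real assume t: "t \<ge> 0"
    show "(LINT x|lborel. w t x * dt \<Psi> (t, x)) = dderiv 1 \<rho> t * weighted_mean i w t"
      by (rule cone_integral_eq[OF w supp[OF t] t smooth_fun_continuous[OF smooth_fun_dt[OF sm]]])
        (simp add: \<Psi>_def dt_time_weight[OF \<rho>(1)])
  qed
  have R: "st_int (\<lambda>t x. w1 t x * \<Psi> (t, x)) = integral {0..S} (\<lambda>t. \<rho> t * weighted_mean i w1 t)"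
    unfolding st_int_def
  proof (rule set_integral_cut_cong)
    show "continuous_on {0..} (\<lambda>t. \<rho> t * weighted_mean i w1 t)"
      by (intro continuous_intros smooth_fun_continuous \<rho>(1) continuous_weighted_mean[OF w1])
    show "(LINT x|lborel. w1 t x * \<Psi> (t, x)) = \<rho> t * weighted_mean i w1 t" for t
      by (simp add: \<Psi>_def weighted_mean_def mult.left_commute[of _ "\<rho> t"])
  qed (simp add: \<rho>(2))
  have tf: "test_fun \<Psi>" unfolding \<Psi>_def by (rule test_fun_time_weight[OF \<rho>(1,2)])
  have z: "\<Psi> (t, x) = 0" if "t \<le> 0" for t x
    using \<rho>(3)[OF that] by (simp add: \<Psi>_def)
  have "st_int (\<lambda>t x. w t x * dt \<Psi> (t, x)) = - st_int (\<lambda>t x. w1 t x * \<Psi> (t, x))"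
    using td tf z unfolding is_time_deriv_def by blast
  then show ?thesis unfolding L R .
qed

section \<open>Boundary terms and initial values at t = 0\<close>

lemma integral_extend_zero:
  fixes g :: "real \<Rightarrow> real"
  assumes "\<delta> \<le> S" "\<And>t. t > \<delta> \<Longrightarrow> g t = 0"
  shows "integral {0..S} g = integral {0..\<delta>} g"
proof -
  have "integral {0..S} g = integral {0..S} (\<lambda>t. if t \<in> {0..\<delta>} then g t else 0)"
    by (rule integral_cong) (use assms in auto)
  also have "\<dots> = integral ({0..\<delta>} \<inter> {0..S}) g" by (rule integral_restrict_Int)
  also have "{0..\<delta>} \<inter> {0..S} = {0..\<delta>}" using assms by auto
  finally show ?thesis .
qed

lemma plateau_has_derivative [derivative_intros]:
  assumes "(h has_real_derivative d) (at x)"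
  shows "((\<lambda>x. plateau (h x)) has_real_derivative dderiv 1 plateau (h x) * d) (at x)"
    and "((\<lambda>x. dderiv 1 plateau (h x)) has_real_derivative dderiv 1 (dderiv 1 plateau) (h x) * d) (at x)"
  by (rule DERIV_chain2[OF _ assms]; intro smooth_fun_real_deriv smooth_fun_real_dderiv smooth_fun_plateau)+

lemma integral_eq_primitive:
  fixes h :: "real \<Rightarrow> real"
  assumes "\<And>x. (h has_real_derivative h' x) (at x)"
  shows "integral {0..1} h' = h 1 - h 0"
  using fundamental_theorem_of_calculus[of 0 1 h h'] assms
  by (intro integral_unique)
    (auto simp: has_real_derivative_iff_has_vector_derivative[symmetric] intro: DERIV_subset)

lemma tendsto_concentrated_integral:
  fixes g k :: "real \<Rightarrow> real"
  assumes "continuous_on {0..} g" "continuous_on {0..1} k"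
  shows "((\<lambda>\<delta>. integral {0..\<delta>} (\<lambda>t. g t * k (t / \<delta>))) \<longlongrightarrow> 0) (at_right 0)"
proof -
  have "((\<lambda>\<delta>. \<delta> * integral {0..\<delta>} (\<lambda>t. g t * k (t / \<delta>) / \<delta>)) \<longlongrightarrow> 0 * (g 0 * integral {0..1} k)) (at_right 0)"
    by (intro tendsto_mult tendsto_rescaled_integral assms) (simp add: tendsto_ident_at)
  then have "((\<lambda>\<delta>. \<delta> * integral {0..\<delta>} (\<lambda>t. g t * k (t / \<delta>) / \<delta>)) \<longlongrightarrow> 0) (at_right 0)"
    by simp
  then show ?thesis
    by (rule Lim_transform_eventually)
      (auto simp: eventually_at_right_field integral_divide intro!: exI[of _ 1])
qed

text \<open>Cutting a test function off near \<open>t = 0\<close> at scale \<open>\<delta>\<close> and letting \<open>\<delta>\<close> tend to zero produces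
  the boundary term.\<close>

lemma time_deriv_boundary:
  fixes U A :: "real \<Rightarrow> real"
  assumes U: "continuous_on {0..} U" and A: "continuous_on {0..} A" and S: "S > 0"
    and td: "\<And>\<rho>. smooth_fun \<rho> \<Longrightarrow> (\<And>t. t \<ge> S \<Longrightarrow> \<rho> t = 0) \<Longrightarrow> (\<And>t. t \<le> 0 \<Longrightarrow> \<rho> t = 0) \<Longrightarrow>
      integral {0..S} (\<lambda>t. dderiv 1 \<rho> t * U t) = - integral {0..S} (\<lambda>t. \<rho> t * A t)"
    and \<rho>: "smooth_fun \<rho>" "\<And>t. t \<ge> S \<Longrightarrow> \<rho> t = 0"
  shows "integral {0..S} (\<lambda>t. dderiv 1 \<rho> t * U t) = - integral {0..S} (\<lambda>t. \<rho> t * A t) - \<rho> 0 * U 0"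
proof -
  let ?pl = "plateau" and ?pl' = "dderiv 1 plateau" and ?\<rho>' = "dderiv 1 \<rho>"
  have c: "continuous_on X ?pl" "continuous_on X ?pl'" "continuous_on X ?\<rho>'" "continuous_on X \<rho>" for X
    by (intro smooth_fun_continuous smooth_fun_real_dderiv smooth_fun_plateau \<rho>(1))+
  \<comment> \<open>D is the defect in the integration by parts, to be identified as -\<rho>(0)
    U(0). The identity below expresses it by two integrals over [0,\<delta>], while D itself does
    not depend on \<delta>.\<close>
  define D where "D = integral {0..S} (\<lambda>t. ?\<rho>' t * U t + \<rho> t * A t)"
  have DU: "continuous_on {0..S} U" "continuous_on {0..S} A"
    using U A by (auto intro: continuous_on_subset)
  have eq: "integral {0..\<delta>} (\<lambda>t. (\<rho> t * U t) * ?pl' (t / \<delta>) / \<delta>)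
      + integral {0..\<delta>} (\<lambda>t. (?\<rho>' t * U t + \<rho> t * A t) * ?pl (t / \<delta>)) = D"
    if \<delta>: "0 < \<delta>" "\<delta> \<le> S" for \<delta>
  proof -
    \<comment> \<open>The function vanishes for t \<le> \<delta>/2 and is therefore admissible in
      \<open>td\<close>. The derivative of the cutoff contributes a kernel at scale \<delta> of
      total mass -1, which produces the boundary term.\<close>
    define \<theta> where "\<theta> t = \<rho> t * (1 - ?pl (t / \<delta>))" for t
    have sm\<theta>: "smooth_fun \<theta>"
    proof -
      have "smooth_fun (\<lambda>t. \<rho> t * (1 - ?pl (t * (1 / \<delta>))))"
        by (intro smooth_fun_mult smooth_fun_diff smooth_fun_const \<rho>(1)
            smooth_fun_compose[OF smooth_fun_plateau] smooth_fun_real_id)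
      then show ?thesis by (simp add: \<theta>_def[abs_def])
    qed
    have d\<theta>: "dderiv 1 \<theta> t = ?\<rho>' t * (1 - ?pl (t / \<delta>)) - \<rho> t * (?pl' (t / \<delta>) / \<delta>)" for t
      unfolding \<theta>_def[abs_def] using \<delta>
      by (intro dderiv_real_eq) (auto intro!: derivative_eq_intros smooth_fun_real_deriv[OF \<rho>(1)])
    have "integral {0..S} (\<lambda>t. dderiv 1 \<theta> t * U t) = - integral {0..S} (\<lambda>t. \<theta> t * A t)"
    proof (rule td[OF sm\<theta>])
      show "\<theta> t = 0" if "t \<ge> S" for t using \<rho>(2)[OF that] by (simp add: \<theta>_def)
      fix t :: real assume "t \<le> 0"
      then have "t / \<delta> \<le> 1/2" using \<delta> divide_nonpos_pos[of t \<delta>] by linarith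
      then show "\<theta> t = 0" by (simp add: \<theta>_def plateau_eq_1)
    qed
    moreover have ci: "continuous_on {0..S} (\<lambda>t. dderiv 1 \<theta> t * U t)" "continuous_on {0..S} (\<lambda>t. \<theta> t * A t)"
      by (intro continuous_intros DU smooth_fun_continuous smooth_fun_real_dderiv sm\<theta>)+
    ultimately have "integral {0..S} (\<lambda>t. dderiv 1 \<theta> t * U t + \<theta> t * A t) = 0"
      by (subst Henstock_Kurzweil_Integration.integral_add) (auto intro: integrable_continuous_interval)
    then have "D = integral {0..S} (\<lambda>t. ?\<rho>' t * U t + \<rho> t * A t)
        - integral {0..S} (\<lambda>t. dderiv 1 \<theta> t * U t + \<theta> t * A t)" by (simp add: D_def)
    also have "\<dots> = integral {0..S} (\<lambda>t. (?\<rho>' t * U t + \<rho> t * A t) - (dderiv 1 \<theta> t * U t + \<theta> t * A t))"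
      by (intro Henstock_Kurzweil_Integration.integral_diff[symmetric] integrable_continuous_interval
          continuous_intros DU c smooth_fun_continuous smooth_fun_real_dderiv sm\<theta>)
    also have "(\<lambda>t. (?\<rho>' t * U t + \<rho> t * A t) - (dderiv 1 \<theta> t * U t + \<theta> t * A t))
        = (\<lambda>t. (\<rho> t * U t) * ?pl' (t / \<delta>) / \<delta> + (?\<rho>' t * U t + \<rho> t * A t) * ?pl (t / \<delta>))"
      by (rule ext) (simp add: d\<theta> \<theta>_def algebra_simps)
    also have "integral {0..S} \<dots> = integral {0..\<delta>} \<dots>"
    proof (rule integral_extend_zero[OF \<delta>(2)])
      fix t assume "t > \<delta>"
      then have "t / \<delta> \<ge> 1" using \<delta> by simp
      then show "(\<rho> t * U t) * ?pl' (t / \<delta>) / \<delta> + (?\<rho>' t * U t + \<rho> t * A t) * ?pl (t / \<delta>) = 0"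
        using plateau_eq_0 dderiv_eq_0_from[OF smooth_fun_plateau plateau_eq_0, of 1 "t / \<delta>"] by simp
    qed
    also have "\<dots> = integral {0..\<delta>} (\<lambda>t. (\<rho> t * U t) * ?pl' (t / \<delta>) / \<delta>)
      + integral {0..\<delta>} (\<lambda>t. (?\<rho>' t * U t + \<rho> t * A t) * ?pl (t / \<delta>))"
      using \<delta> by (intro Henstock_Kurzweil_Integration.integral_add integrable_continuous_interval
          continuous_intros continuous_on_compose2[OF c(1)] continuous_on_compose2[OF c(2)] c
          continuous_on_subset[OF U] continuous_on_subset[OF A]) auto
    finally show ?thesis by simp
  qed
  have "((\<lambda>\<delta>. integral {0..\<delta>} (\<lambda>t. (\<rho> t * U t) * ?pl' (t / \<delta>) / \<delta>)
      + integral {0..\<delta>} (\<lambda>t. (?\<rho>' t * U t + \<rho> t * A t) * ?pl (t / \<delta>)))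
      \<longlongrightarrow> (\<rho> 0 * U 0) * integral {0..1} ?pl' + 0) (at_right 0)"
    by (intro tendsto_add tendsto_rescaled_integral[where g="\<lambda>t. \<rho> t * U t"]
        tendsto_concentrated_integral continuous_intros c U A)
  moreover have "((\<lambda>\<delta>. integral {0..\<delta>} (\<lambda>t. (\<rho> t * U t) * ?pl' (t / \<delta>) / \<delta>)
      + integral {0..\<delta>} (\<lambda>t. (?\<rho>' t * U t + \<rho> t * A t) * ?pl (t / \<delta>))) \<longlongrightarrow> D) (at_right 0)"
    by (rule Lim_transform_eventually[OF tendsto_const])
      (use eq S in \<open>auto simp: eventually_at_right_field intro!: exI[of _ S]\<close>)
  ultimately have "D = (\<rho> 0 * U 0) * integral {0..1} ?pl'"
    using tendsto_unique[OF trivial_limit_at_right_real] by fastforce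
  moreover have "integral {0..1} ?pl' = - 1"
    using integral_eq_primitive[OF smooth_fun_real_deriv[OF smooth_fun_plateau]]
    by (simp add: plateau_eq_1 plateau_eq_0)
  moreover have "D = integral {0..S} (\<lambda>t. ?\<rho>' t * U t) + integral {0..S} (\<lambda>t. \<rho> t * A t)"
    unfolding D_def
    by (intro Henstock_Kurzweil_Integration.integral_add integrable_continuous_interval continuous_intros c DU)
  ultimately show ?thesis by simp
qed

text \<open>Test with t times a plateau at scale \<delta>: it has value 0 and slope 1 at t = 0, so
  of the data only -\<epsilon> H remains. Its second derivative is a kernel at scale \<delta> of
  mass -1 and gives -U(0) in the limit; the other terms vanish with \<delta>.\<close>

lemma wave_initial_value:
  fixes U F :: "real \<Rightarrow> real"
  assumes U: "continuous_on {0..} U" and F: "continuous_on {0..} F" and S: "S > 0"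
    and we: "\<And>\<rho>. smooth_fun \<rho> \<Longrightarrow> (\<And>t. t \<ge> S \<Longrightarrow> \<rho> t = 0) \<Longrightarrow>
      integral {0..S} (\<lambda>t. (dderiv 1 (dderiv 1 \<rho>) t - \<rho> t) * U t)
      = integral {0..S} (\<lambda>t. \<rho> t * F t) + \<epsilon> * (\<rho> 0 * G) - \<epsilon> * (dderiv 1 \<rho> 0 * H)"
  shows "U 0 = \<epsilon> * H"
proof -
  let ?pl = "plateau" and ?pl' = "dderiv 1 plateau" and ?pl'' = "dderiv 1 (dderiv 1 plateau)"
  \<comment> \<open>k is the second derivative of s times the plateau; its integral over [0,1] is
    the change of the first derivative, from 1 to 0.\<close>
  define k where "k s = 2 * ?pl' s + s * ?pl'' s" for s
  have c: "continuous_on X ?pl" "continuous_on X ?pl'" "continuous_on X ?pl''" for X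
    by (intro smooth_fun_continuous smooth_fun_real_dderiv smooth_fun_plateau)+
  have ck: "continuous_on X k" for X
    unfolding k_def by (intro continuous_intros c)
  have z1: "?pl' t = 0" if "t \<ge> 1" for t
    using dderiv_eq_0_from[OF smooth_fun_plateau plateau_eq_0 that] .
  have z2: "?pl'' t = 0" if "t \<ge> 1" for t
    using dderiv_eq_0_from[OF smooth_fun_real_dderiv[OF smooth_fun_plateau] z1 that] .
  note z = plateau_eq_0 z1 z2
  have eq: "integral {0..\<delta>} (\<lambda>t. U t * k (t / \<delta>) / \<delta>)
      - integral {0..\<delta>} (\<lambda>t. (t * (U t + F t)) * ?pl (t / \<delta>)) = - \<epsilon> * H"
    if \<delta>: "0 < \<delta>" "\<delta> \<le> S" for \<delta>
  proof -
    define \<theta> where "\<theta> t = t * ?pl (t / \<delta>)" for t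
    have sm: "smooth_fun \<theta>"
    proof -
      have "smooth_fun (\<lambda>t. t * ?pl (t * (1 / \<delta>)))"
        by (intro smooth_fun_mult smooth_fun_const smooth_fun_compose[OF smooth_fun_plateau] smooth_fun_real_id)
      then show ?thesis by (simp add: \<theta>_def[abs_def])
    qed
    have d1: "dderiv 1 \<theta> = (\<lambda>t. ?pl (t / \<delta>) + t / \<delta> * ?pl' (t / \<delta>))"
      unfolding \<theta>_def[abs_def] using \<delta>
      by (intro ext dderiv_real_eq) (auto intro!: derivative_eq_intros)
    have d2: "dderiv 1 (dderiv 1 \<theta>) t = k (t / \<delta>) / \<delta>" for t
      unfolding d1 k_def using \<delta>
      by (intro dderiv_real_eq) (auto intro!: derivative_eq_intros simp: field_simps)
    have far: "t / \<delta> \<ge> 1" if "t \<ge> \<delta>" for t using that \<delta> by simp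
    have "integral {0..S} (\<lambda>t. (dderiv 1 (dderiv 1 \<theta>) t - \<theta> t) * U t)
        = integral {0..S} (\<lambda>t. \<theta> t * F t) - \<epsilon> * H"
      using we[OF sm] \<delta> far z by (simp add: \<theta>_def d1 plateau_eq_1)
    also have "integral {0..S} (\<lambda>t. (dderiv 1 (dderiv 1 \<theta>) t - \<theta> t) * U t)
        = integral {0..\<delta>} (\<lambda>t. (dderiv 1 (dderiv 1 \<theta>) t - \<theta> t) * U t)"
      by (rule integral_extend_zero[OF \<delta>(2)]) (use far z in \<open>simp add: d2 \<theta>_def k_def\<close>)
    also have "\<dots> = integral {0..\<delta>} (\<lambda>t. U t * k (t / \<delta>) / \<delta> - \<theta> t * U t)"
      by (simp add: d2 algebra_simps)
    also have "\<dots> = integral {0..\<delta>} (\<lambda>t. U t * k (t / \<delta>) / \<delta>) - integral {0..\<delta>} (\<lambda>t. \<theta> t * U t)"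
      using \<delta> by (intro Henstock_Kurzweil_Integration.integral_diff integrable_continuous_interval
          continuous_intros continuous_on_compose2[OF ck] continuous_on_subset[OF U] smooth_fun_continuous sm) auto
    also have "integral {0..S} (\<lambda>t. \<theta> t * F t) = integral {0..\<delta>} (\<lambda>t. \<theta> t * F t)"
      by (rule integral_extend_zero[OF \<delta>(2)]) (use far z in \<open>simp add: \<theta>_def\<close>)
    finally have "integral {0..\<delta>} (\<lambda>t. U t * k (t / \<delta>) / \<delta>)
        - (integral {0..\<delta>} (\<lambda>t. \<theta> t * U t) + integral {0..\<delta>} (\<lambda>t. \<theta> t * F t)) = - \<epsilon> * H" by simp
    moreover have "integral {0..\<delta>} (\<lambda>t. \<theta> t * U t) + integral {0..\<delta>} (\<lambda>t. \<theta> t * F t)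
        = integral {0..\<delta>} (\<lambda>t. \<theta> t * U t + \<theta> t * F t)"
      using \<delta> by (intro Henstock_Kurzweil_Integration.integral_add[symmetric] integrable_continuous_interval
          continuous_intros continuous_on_subset[OF U] continuous_on_subset[OF F] smooth_fun_continuous sm) auto
    moreover have "(\<lambda>t. \<theta> t * U t + \<theta> t * F t) = (\<lambda>t. (t * (U t + F t)) * ?pl (t / \<delta>))"
      by (rule ext) (simp add: \<theta>_def algebra_simps)
    ultimately show ?thesis by simp
  qed
  have "((\<lambda>\<delta>. integral {0..\<delta>} (\<lambda>t. U t * k (t / \<delta>) / \<delta>)
      - integral {0..\<delta>} (\<lambda>t. (t * (U t + F t)) * ?pl (t / \<delta>))) \<longlongrightarrow> U 0 * integral {0..1} k - 0) (at_right 0)"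
    by (intro tendsto_diff tendsto_rescaled_integral tendsto_concentrated_integral continuous_intros ck c U F)
  moreover have "((\<lambda>\<delta>. integral {0..\<delta>} (\<lambda>t. U t * k (t / \<delta>) / \<delta>)
      - integral {0..\<delta>} (\<lambda>t. (t * (U t + F t)) * ?pl (t / \<delta>))) \<longlongrightarrow> - \<epsilon> * H) (at_right 0)"
    by (rule Lim_transform_eventually[OF tendsto_const])
      (use eq S in \<open>auto simp: eventually_at_right_field intro!: exI[of _ S]\<close>)
  ultimately have "U 0 * integral {0..1} k = - \<epsilon> * H"
    using tendsto_unique[OF trivial_limit_at_right_real] by fastforce
  moreover have "integral {0..1} k = - 1"
  proof -
    have "((\<lambda>s. ?pl s + s * ?pl' s) has_real_derivative k s) (at s)" for s
      unfolding k_def by (auto intro!: derivative_eq_intros)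
    from integral_eq_primitive[OF this] show ?thesis
      using z[of 1] by (simp add: plateau_eq_1)
  qed
  ultimately show ?thesis by simp
qed

text \<open>Testing with -\<rho>' puts -P' against U, where P = \<rho>'' - \<rho>; integration by
  parts gives P against A and the boundary term P(0) U(0). With U(0) = \<epsilon> H its \<rho>''(0)
  part cancels the one coming from the data, so only \<rho>(0) and \<rho>'(0), whose signs are known
  for the profile, remain.\<close>

lemma wave_time_deriv:
  fixes U A F :: "real \<Rightarrow> real"
  assumes U: "continuous_on {0..} U" and A: "continuous_on {0..} A" and F: "continuous_on {0..} F"
    and S: "S > 0"
    and td: "\<And>\<rho>. smooth_fun \<rho> \<Longrightarrow> (\<And>t. t \<ge> S \<Longrightarrow> \<rho> t = 0) \<Longrightarrow> (\<And>t. t \<le> 0 \<Longrightarrow> \<rho> t = 0) \<Longrightarrow>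
      integral {0..S} (\<lambda>t. dderiv 1 \<rho> t * U t) = - integral {0..S} (\<lambda>t. \<rho> t * A t)"
    and we: "\<And>\<rho>. smooth_fun \<rho> \<Longrightarrow> (\<And>t. t \<ge> S \<Longrightarrow> \<rho> t = 0) \<Longrightarrow>
      integral {0..S} (\<lambda>t. (dderiv 1 (dderiv 1 \<rho>) t - \<rho> t) * U t)
      = integral {0..S} (\<lambda>t. \<rho> t * F t) + \<epsilon> * (\<rho> 0 * G) - \<epsilon> * (dderiv 1 \<rho> 0 * H)"
    and \<rho>: "smooth_fun \<rho>" "\<And>t. t \<ge> S \<Longrightarrow> \<rho> t = 0"
  shows "integral {0..S} (\<lambda>t. (dderiv 1 (dderiv 1 \<rho>) t - \<rho> t) * A t)
    = integral {0..S} (\<lambda>t. - dderiv 1 \<rho> t * F t) + \<epsilon> * (\<rho> 0 * H) - \<epsilon> * (dderiv 1 \<rho> 0 * G)"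
proof -
  let ?\<rho>1 = "dderiv 1 \<rho>" and ?\<rho>2 = "dderiv 1 (dderiv 1 \<rho>)" and ?\<rho>3 = "dderiv 1 (dderiv 1 (dderiv 1 \<rho>))"
  note sm1 = smooth_fun_real_dderiv[OF \<rho>(1)]
  note sm2 = smooth_fun_real_dderiv[OF sm1]
  have z1: "?\<rho>1 t = 0" if "t \<ge> S" for t
    by (rule dderiv_eq_0_from[OF \<rho>(1) _ that]) (rule \<rho>(2))
  have z2: "?\<rho>2 t = 0" if "t \<ge> S" for t
    by (rule dderiv_eq_0_from[OF sm1 _ that]) (rule z1)
  have smP: "smooth_fun (\<lambda>t. ?\<rho>2 t - \<rho> t)" and smR: "smooth_fun (\<lambda>t. - ?\<rho>1 t)"
    by (intro smooth_fun_diff smooth_fun_minus \<rho>(1) sm1 sm2)+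
  have dP: "dderiv 1 (\<lambda>t. ?\<rho>2 t - \<rho> t) = (\<lambda>t. ?\<rho>3 t - ?\<rho>1 t)"
    by (intro ext dderiv_real_eq) (auto intro!: derivative_intros smooth_fun_real_deriv \<rho>(1) sm2)
  have dR: "dderiv 1 (\<lambda>t. - ?\<rho>1 t) = (\<lambda>t. - ?\<rho>2 t)"
    by (intro ext dderiv_real_eq) (auto intro!: derivative_intros smooth_fun_real_deriv sm1)
  have dR2: "dderiv 1 (\<lambda>t. - ?\<rho>2 t) = (\<lambda>t. - ?\<rho>3 t)"
    by (intro ext dderiv_real_eq) (auto intro!: derivative_intros smooth_fun_real_deriv sm2)
  have zP: "?\<rho>2 t - \<rho> t = 0" and zR: "- ?\<rho>1 t = 0" if "t \<ge> S" for t
    using z1[OF that] z2[OF that] \<rho>(2)[OF that] by simp_all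
  have "integral {0..S} (\<lambda>t. (?\<rho>3 t - ?\<rho>1 t) * U t)
      = - integral {0..S} (\<lambda>t. (?\<rho>2 t - \<rho> t) * A t) - (?\<rho>2 0 - \<rho> 0) * U 0"
  proof -
    have "integral {0..S} (\<lambda>t. dderiv 1 (\<lambda>t. ?\<rho>2 t - \<rho> t) t * U t)
        = - integral {0..S} (\<lambda>t. (?\<rho>2 t - \<rho> t) * A t) - (?\<rho>2 0 - \<rho> 0) * U 0"
      by (rule time_deriv_boundary[OF U A S _ smP zP]) (rule td)
    then show ?thesis unfolding dP .
  qed
  moreover have "integral {0..S} (\<lambda>t. (- ?\<rho>3 t - - ?\<rho>1 t) * U t)
      = integral {0..S} (\<lambda>t. - ?\<rho>1 t * F t) + \<epsilon> * (- ?\<rho>1 0 * G) - \<epsilon> * (- ?\<rho>2 0 * H)"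
    using we[OF smR zR] unfolding dR dR2 .
  moreover have "integral {0..S} (\<lambda>t. (- ?\<rho>3 t - - ?\<rho>1 t) * U t) = - integral {0..S} (\<lambda>t. (?\<rho>3 t - ?\<rho>1 t) * U t)"
    by (subst Henstock_Kurzweil_Integration.integral_neg[symmetric]) (simp add: algebra_simps)
  moreover have "U 0 = \<epsilon> * H"
    by (rule wave_initial_value[OF U F S]) (rule we)
  ultimately show ?thesis by (simp add: algebra_simps)
qed

section \<open>Nonexistence\<close>

text \<open>Young's inequality for the factors \<kappa>^{1/r} a and \<kappa>^{-1/r} s, with the
  divisors r and r/(r - 1), both above 1, dropped.\<close>

lemma scaled_Young:
  fixes a s r \<kappa> :: real
  assumes "a \<ge> 0" "s \<ge> 0" "r > 1" "\<kappa> > 0"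
  shows "a * s \<le> \<kappa> * a powr r + \<kappa> powr (- 1 / (r - 1)) * s powr (r / (r - 1))"
proof -
  define r' where "r' = r / (r - 1)"
  have r': "r' > 1" "1 / r + 1 / r' = 1" using assms by (auto simp: r'_def field_simps)
  have "(\<kappa> powr (1 / r) * a) * (\<kappa> powr (- 1 / r) * s)
      \<le> (\<kappa> powr (1 / r) * a) powr r / r + (\<kappa> powr (- 1 / r) * s) powr r' / r'"
    using assms r' by (intro Youngs_inequality) auto
  also have "(\<kappa> powr (1 / r) * a) * (\<kappa> powr (- 1 / r) * s) = a * s"
    using assms by (simp add: powr_minus field_simps)
  also have "(\<kappa> powr (1 / r) * a) powr r = \<kappa> * a powr r"
    using assms by (simp add: powr_mult powr_powr)
  also have "(\<kappa> powr (- 1 / r) * s) powr r' = \<kappa> powr (- 1 / (r - 1)) * s powr r'"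
    using assms by (simp add: powr_mult powr_powr r'_def)
  also have "\<kappa> * a powr r / r \<le> \<kappa> * a powr r"
    using assms divide_left_mono[of 1 r "\<kappa> * a powr r"] by simp
  also have "\<kappa> powr (- 1 / (r - 1)) * s powr r' / r' \<le> \<kappa> powr (- 1 / (r - 1)) * s powr r'"
    using r' divide_left_mono[of 1 r' "\<kappa> powr (- 1 / (r - 1)) * s powr r'"] by simp
  finally show ?thesis by (simp add: r'_def)
qed

section \<open>The time factor and its defect\<close>

text \<open>The time factor of the test functions; no plateau near \<open>t = 0\<close> is needed because the initial
  data enter with a favourable sign.\<close>

definition profile :: "real \<Rightarrow> real \<Rightarrow> real" where
  "profile T t = exp (- t) * flat 1 (1 - t / T)"

text \<open>This is \<rho>'' - \<rho> for the profile \<rho>: the factor e^{-t} cancels the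
  undifferentiated E, and E' / T and E'' / T^2 remain. Here \<open>flat (flat_step 1)\<close> is
  E'.\<close>

definition profile_defect :: "real \<Rightarrow> real \<Rightarrow> real" where
  "profile_defect T t = exp (- t) *
     (2 * flat (flat_step 1) (1 - t / T) / T + flat (flat_step (flat_step 1)) (1 - t / T) / T\<^sup>2)"

lemma smooth_fun_profile: "smooth_fun (profile T)"
proof -
  have "smooth_fun (\<lambda>t. exp (- t) * flat 1 (1 - t * (1 / T)))"
    by (intro smooth_fun_mult smooth_fun_compose[OF smooth_fun_exp] smooth_fun_compose[OF smooth_fun_flat]
        smooth_fun_diff smooth_fun_minus smooth_fun_const smooth_fun_real_id)
  then show ?thesis by (simp add: profile_def[abs_def])
qed

lemma profile_eq_0: "T > 0 \<Longrightarrow> t \<ge> T \<Longrightarrow> profile T t = 0"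
  by (simp add: profile_def flat_def)

lemma profile_deriv:
  assumes "T > 0"
  shows "dderiv 1 (profile T) = (\<lambda>t. - exp (- t) * (flat 1 (1 - t / T) + flat (flat_step 1) (1 - t / T) / T))"
  unfolding profile_def[abs_def] using assms
  by (intro ext dderiv_real_eq)
    (auto intro!: derivative_eq_intros DERIV_chain2[OF flat_has_derivative] simp: algebra_simps)

lemma profile_defect_eq:
  assumes "T > 0"
  shows "dderiv 1 (dderiv 1 (profile T)) t - profile T t = profile_defect T t"
proof -
  have "dderiv 1 (dderiv 1 (profile T)) t = exp (- t) * (flat 1 (1 - t / T)
      + 2 * flat (flat_step 1) (1 - t / T) / T + flat (flat_step (flat_step 1)) (1 - t / T) / T\<^sup>2)"
    unfolding profile_deriv[OF assms] using assms
    by (intro dderiv_real_eq)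
      (auto intro!: derivative_eq_intros DERIV_chain2[OF flat_has_derivative]
        simp: field_simps power2_eq_square)
  then show ?thesis by (simp add: profile_def profile_defect_def algebra_simps)
qed

lemma poly_flat_step:
  "poly (flat_step 1) y = y\<^sup>2"
  "poly (flat_step (flat_step 1)) y = y ^ 4 - 2 * y ^ 3"
proof -
  have 1: "flat_step 1 = [:0, 0, 1:]" by (simp add: flat_step_def)
  show "poly (flat_step 1) y = y\<^sup>2" by (simp add: 1 power2_eq_square)
  show "poly (flat_step (flat_step 1)) y = y ^ 4 - 2 * y ^ 3"
    by (simp add: 1 flat_step_def pderiv_pCons algebra_simps power4_eq_xxxx power3_eq_cube)
qed

text \<open>Put y = 1/x, which is at least 1 because t \<ge> 0. The polynomials in E' and E'' are
  then bounded together by (2 + 1 + 2) y^4, with T \<ge> 1 replacing 1/T^2 by 1/T. Writing e^{-y} =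
  e^{-y/r} e^{-c y} with c = 1 - 1/r, the second factor absorbs y^4 at the cost of (4/c)^4.\<close>

lemma profile_defect_le:
  fixes r :: real
  assumes "r > 1"
  obtains K where "K > 0"
    "\<And>T t. T \<ge> 1 \<Longrightarrow> t \<ge> 0 \<Longrightarrow> \<bar>profile_defect T t\<bar> \<le> exp (- t) * (flat 1 (1 - t / T) powr (1 / r) * (K / T))"
proof
  define c where "c = 1 - 1 / r"
  have c: "c > 0" using assms by (simp add: c_def)
  show "5 * (4 / c) ^ 4 > 0" using c by simp
  fix T t :: real assume T: "T \<ge> 1" and t: "t \<ge> 0"
  define x where "x = 1 - t / T"
  have x: "x \<le> 1" using T t by (simp add: x_def)
  have "\<bar>2 * flat (flat_step 1) x / T + flat (flat_step (flat_step 1)) x / T\<^sup>2\<bar>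
      \<le> flat 1 x powr (1 / r) * (5 * (4 / c) ^ 4 / T)"
  proof (cases "x > 0")
    case True
    define y where "y = 1 / x"
    have y: "y \<ge> 1" using True x by (simp add: y_def)
    have pw: "y ^ m \<le> y ^ 4" if "m \<le> 4" for m using y that by (intro power_increasing) auto
    have fl: "flat P x = poly P y * exp (- y)" for P using True by (simp add: flat_def y_def)
    have "\<bar>2 * flat (flat_step 1) x / T + flat (flat_step (flat_step 1)) x / T\<^sup>2\<bar>
        \<le> \<bar>2 * flat (flat_step 1) x / T\<bar> + \<bar>flat (flat_step (flat_step 1)) x / T\<^sup>2\<bar>"
      by (rule abs_triangle_ineq)
    also have "\<bar>flat (flat_step (flat_step 1)) x / T\<^sup>2\<bar> \<le> \<bar>flat (flat_step (flat_step 1)) x\<bar> / T"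
      using T self_le_power[of T 2] by (auto simp: abs_divide intro!: divide_left_mono)
    also have "\<bar>2 * flat (flat_step 1) x / T\<bar> = 2 * y\<^sup>2 * exp (- y) / T"
      using T by (simp add: fl poly_flat_step abs_mult)
    also have "\<bar>flat (flat_step (flat_step 1)) x\<bar> \<le> (y ^ 4 + 2 * y ^ 3) * exp (- y)"
      using y unfolding fl poly_flat_step abs_mult
      by (intro mult_mono order_trans[OF abs_triangle_ineq4]) auto
    also have "2 * y\<^sup>2 * exp (- y) / T + (y ^ 4 + 2 * y ^ 3) * exp (- y) / T
        = (2 * y\<^sup>2 + y ^ 4 + 2 * y ^ 3) * (exp (- y) / T)"
      by (simp add: add_divide_distrib algebra_simps)
    also have "\<dots> \<le> (5 * y ^ 4) * (exp (- y) / T)"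
      using pw[of 2] pw[of 3] T by (intro mult_right_mono) auto
    also have "\<dots> \<le> (5 * ((4 / c) ^ 4 * exp (c * y))) * (exp (- y) / T)"
      using power_le_exp[of y c 4] c y T by (intro mult_right_mono) auto
    also have "\<dots> = (exp (c * y) * exp (- y)) * (5 * (4 / c) ^ 4 / T)"
      by simp
    also have "exp (c * y) * exp (- y) = flat 1 x powr (1 / r)"
      by (simp add: fl c_def exp_powr_real exp_add[symmetric] algebra_simps)
    finally show ?thesis using T by (simp add: divide_right_mono add_mono)
  qed (simp add: flat_def)
  then show "\<bar>profile_defect T t\<bar> \<le> exp (- t) * (flat 1 (1 - t / T) powr (1 / r) * (5 * (4 / c) ^ 4 / T))"
    unfolding profile_defect_def x_def abs_mult by (intro mult_mono) auto
qed

lemma continuous_profile_defect: "T > 0 \<Longrightarrow> continuous_on X (profile_defect T)"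
proof -
  assume T: "T > 0"
  have "continuous_on X (\<lambda>t. dderiv 1 (dderiv 1 (profile T)) t - profile T t)"
    by (intro continuous_intros smooth_fun_continuous smooth_fun_real_dderiv smooth_fun_profile)
  then show ?thesis using profile_defect_eq[OF T] by simp
qed

lemma weighted_mean_nonneg: "(\<And>x. w t x \<ge> 0) \<Longrightarrow> weighted_mean i w t \<ge> 0"
  unfolding weighted_mean_def by (intro integral_nonneg_AE) (auto intro!: mult_nonneg_nonneg cone_weight_nonneg)

text \<open>The cutoffs enlarge the radius from t + 1 to t + 2, which leaves the growth rate in t
  unchanged.\<close>

lemma integral_cone_weight_le:
  obtains C :: real where "C > 0"
    "\<And>(t::real) (i::'n::finite). t \<ge> 0 \<Longrightarrow> integrable lborel (\<lambda>x. cone_weight i (t, x)) \<and>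
       (LINT x|lborel. cone_weight i (t, x)) \<le> C * (t + 2) powr ((real CARD('n) - 1) / 2) * exp (t + 2)"
proof -
  obtain C where C: "C > 0"
    "\<And>(R::real) (i::'n::finite) (w :: real^'n \<Rightarrow> real). R > 0 \<Longrightarrow> w \<in> borel_measurable lborel \<Longrightarrow>
       (\<And>x. norm (w x) \<le> exp (x $ i) * indicator (cball 0 R) x) \<Longrightarrow>
       integrable lborel w \<and> (LINT x|lborel. w x) \<le> C * R powr ((real CARD('n) - 1) / 2) * exp R"
    using integral_exp_ball_le by metis
  show ?thesis
  proof (rule that[OF C(1)], rule C(2))
    fix t :: real and i :: 'n assume "t \<ge> 0"
    then show "t + 2 > 0" by simp
    have "continuous_on UNIV (\<lambda>x. cone_weight i (t, x))"
      by (rule continuous_on_compose2[OF smooth_fun_continuous[OF smooth_fun_cone_weight]])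
        (auto intro!: continuous_intros)
    then show "(\<lambda>x. cone_weight i (t, x)) \<in> borel_measurable lborel"
      using borel_measurable_continuous_onI by simp
    show "norm (cone_weight i (t, x)) \<le> exp (x $ i) * indicator (cball 0 (t + 2)) x" for x
      using cone_weight_nonzero(2)[of i t x] cone_weight_le[of i "(t, x)"] cone_weight_nonneg[of i "(t, x)"]
      by (cases "cone_weight i (t, x) = 0") auto
  qed
qed

text \<open>Young's inequality is applied pointwise to a = E^{1/r} |w| and s = K/T, so that e^{-t}
  a^r is exactly the profile times |w|^r. The remainder is (K/T)^{r/(r-1)} times the mass of e^{-t}
  e^{x_i}, of order T^{(n-1)/2}; integration over [0,T] adds one power of T.\<close>

lemma profile_defect_Young:
  fixes w :: "real \<Rightarrow> real^'n \<Rightarrow> real" and i :: 'n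
  assumes r: "r > 1" and w: "C_Lr 1 w" "C_Lr r w"
  obtains B where "B > 0"
    "\<And>T \<kappa>. T \<ge> 2 \<Longrightarrow> \<kappa> > 0 \<Longrightarrow> integral {0..T} (\<lambda>t. profile_defect T t * weighted_mean i w t)
      \<le> \<kappa> * integral {0..T} (\<lambda>t. profile T t * weighted_mean i (\<lambda>t x. \<bar>w t x\<bar> powr r) t)
        + B * \<kappa> powr (- 1 / (r - 1)) * T powr ((real CARD('n) + 1) / 2 - r / (r - 1))"
proof -
  define \<mu> where "\<mu> = (real CARD('n) - 1) / 2"
  define r' where "r' = r / (r - 1)"
  have \<mu>: "\<mu> \<ge> 0" by (simp add: \<mu>_def)
  obtain K where K: "K > 0" "\<And>T t. T \<ge> 1 \<Longrightarrow> t \<ge> 0 \<Longrightarrow>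
      \<bar>profile_defect T t\<bar> \<le> exp (- t) * (flat 1 (1 - t / T) powr (1 / r) * (K / T))"
    using profile_defect_le[OF r] by metis
  obtain C where C: "C > 0"
    "\<And>(t::real) (i::'n). t \<ge> 0 \<Longrightarrow> integrable lborel (\<lambda>x. cone_weight i (t, x)) \<and>
       (LINT x|lborel. cone_weight i (t, x)) \<le> C * (t + 2) powr \<mu> * exp (t + 2)"
    using integral_cone_weight_le unfolding \<mu>_def by metis
  define B where "B = K powr r' * (C * 2 powr \<mu> * exp 2)"
  have wr: "C_Lr 1 (\<lambda>t x. \<bar>w t x\<bar> powr r)" by (rule C_Lr_powr[OF w(2) r])
  show ?thesis
  proof
    show "B > 0" using K C by (simp add: B_def)
    fix T \<kappa> :: real assume T: "T \<ge> 2" and \<kappa>: "\<kappa> > 0"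
    define L where "L = \<kappa> powr (- 1 / (r - 1))"
    have L: "L \<ge> 0" by (simp add: L_def)
    \<comment> \<open>A bound for the remainder that is uniform in t: e^{-t} cancels the e^{t + 2}
      of the mass estimate, and t + 2 \<le> 2 T because T \<ge> 2.\<close>
    define Q where "Q = L * (K / T) powr r' * (C * (2 * T) powr \<mu> * exp 2)"
    have pt: "profile_defect T t * weighted_mean i w t
        \<le> \<kappa> * (profile T t * weighted_mean i (\<lambda>t x. \<bar>w t x\<bar> powr r) t) + Q" if t: "t \<in> {0..T}" for t
    proof -
      have t0: "t \<ge> 0" using t by simp
      define e where "e = flat 1 (1 - t / T)"
      have e: "e \<ge> 0" by (simp add: e_def flat_one_nonneg)
      let ?\<omega> = "\<lambda>x. cone_weight i (t, x)"
      let ?k = "exp (- t) * (L * (K / T) powr r')"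
      have "profile_defect T t * weighted_mean i w t = (LINT x|lborel. profile_defect T t * (w t x * ?\<omega> x))"
        by (simp add: weighted_mean_def)
      also have "\<dots> \<le> (LINT x|lborel. \<kappa> * profile T t * (\<bar>w t x\<bar> powr r * ?\<omega> x) + ?k * ?\<omega> x)"
      proof (rule integral_mono)
        show "integrable lborel (\<lambda>x. profile_defect T t * (w t x * ?\<omega> x))"
          using integrable_cone_weight[OF w(1) t0, of i] by simp
        show "integrable lborel (\<lambda>x. \<kappa> * profile T t * (\<bar>w t x\<bar> powr r * ?\<omega> x) + ?k * ?\<omega> x)"
          using integrable_cone_weight[OF wr t0, of i] C(2)[OF t0, of i] by simp
        fix x
        have "profile_defect T t * w t x \<le> \<bar>profile_defect T t\<bar> * \<bar>w t x\<bar>"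
          unfolding abs_mult[symmetric] by simp
        also have "\<dots> \<le> exp (- t) * (e powr (1 / r) * (K / T)) * \<bar>w t x\<bar>"
          using K(2)[of T t] T t0 by (intro mult_right_mono) (auto simp: e_def)
        also have "\<dots> = exp (- t) * ((e powr (1 / r) * \<bar>w t x\<bar>) * (K / T))" by simp
        also have "\<dots> \<le> exp (- t) * (\<kappa> * (e powr (1 / r) * \<bar>w t x\<bar>) powr r + L * (K / T) powr r')"
          unfolding L_def r'_def by (intro mult_left_mono scaled_Young r \<kappa>) (use K T e in auto)
        also have "(e powr (1 / r) * \<bar>w t x\<bar>) powr r = e * \<bar>w t x\<bar> powr r"
          using e r by (simp add: powr_mult powr_powr)
        also have "exp (- t) * (\<kappa> * (e * \<bar>w t x\<bar> powr r) + L * (K / T) powr r')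
            = \<kappa> * profile T t * \<bar>w t x\<bar> powr r + ?k"
          by (simp add: profile_def e_def algebra_simps)
        finally have "profile_defect T t * w t x * ?\<omega> x \<le> (\<kappa> * profile T t * \<bar>w t x\<bar> powr r + ?k) * ?\<omega> x"
          by (intro mult_right_mono cone_weight_nonneg)
        then show "profile_defect T t * (w t x * ?\<omega> x) \<le> \<kappa> * profile T t * (\<bar>w t x\<bar> powr r * ?\<omega> x) + ?k * ?\<omega> x"
          by (simp only: mult.assoc distrib_right)
      qed
      also have "\<dots> = \<kappa> * (profile T t * weighted_mean i (\<lambda>t x. \<bar>w t x\<bar> powr r) t) + ?k * (LINT x|lborel. ?\<omega> x)"
        using integrable_cone_weight[OF wr t0, of i] C(2)[OF t0, of i] by (simp add: weighted_mean_def)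
      also have "?k * (LINT x|lborel. ?\<omega> x) \<le> ?k * (C * (2 * T) powr \<mu> * exp (t + 2))"
      proof (rule mult_left_mono)
        have "(t + 2) powr \<mu> \<le> (2 * T) powr \<mu>" using t T \<mu> by (intro powr_mono2) auto
        then have "C * (t + 2) powr \<mu> * exp (t + 2) \<le> C * (2 * T) powr \<mu> * exp (t + 2)"
          using C(1) by simp
        then show "(LINT x|lborel. ?\<omega> x) \<le> C * (2 * T) powr \<mu> * exp (t + 2)"
          using C(2)[OF t0, of i] by linarith
      qed (use L in simp)
      also have "?k * (C * (2 * T) powr \<mu> * exp (t + 2)) = Q"
        by (simp add: Q_def exp_add exp_minus)
      finally show ?thesis by simp
    qed
    have c: "continuous_on {0..T} (weighted_mean i w)"
      "continuous_on {0..T} (weighted_mean i (\<lambda>t x. \<bar>w t x\<bar> powr r))"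
      by (rule continuous_on_subset[OF continuous_weighted_mean[OF w(1)]], force)
        (rule continuous_on_subset[OF continuous_weighted_mean[OF wr]], force)
    have i1: "(\<lambda>t. profile_defect T t * weighted_mean i w t) integrable_on {0..T}"
      using T by (intro integrable_continuous_interval continuous_intros c continuous_profile_defect) simp
    have i2: "(\<lambda>t. profile T t * weighted_mean i (\<lambda>t x. \<bar>w t x\<bar> powr r) t) integrable_on {0..T}"
      by (intro integrable_continuous_interval continuous_intros c smooth_fun_continuous smooth_fun_profile)
    have i3: "(\<lambda>t. \<kappa> * (profile T t * weighted_mean i (\<lambda>t x. \<bar>w t x\<bar> powr r) t)) integrable_on {0..T}"
      using i2 by (rule integrable_on_mult_right)
    have "integral {0..T} (\<lambda>t. profile_defect T t * weighted_mean i w t)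
        \<le> integral {0..T} (\<lambda>t. \<kappa> * (profile T t * weighted_mean i (\<lambda>t x. \<bar>w t x\<bar> powr r) t) + Q)"
      using pt by (intro integral_le i1 Henstock_Kurzweil_Integration.integrable_add i3 integrable_const_ivl)
    also have "\<dots> = \<kappa> * integral {0..T} (\<lambda>t. profile T t * weighted_mean i (\<lambda>t x. \<bar>w t x\<bar> powr r) t) + T * Q"
      using T by (simp add: Henstock_Kurzweil_Integration.integral_add[OF i3 integrable_const_ivl])
    also have "T * Q = B * L * (T * T powr \<mu> * T powr (- r'))"
      using T K by (simp add: Q_def B_def powr_mult powr_divide powr_minus field_simps)
    also have "T * T powr \<mu> * T powr (- r') = T powr (1 + \<mu> - r')"
      using T by (simp add: powr_add[symmetric] powr_mult_base)
    also have "1 + \<mu> - r' = (real CARD('n) + 1) / 2 - r / (r - 1)"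
      by (simp add: \<mu>_def r'_def field_simps)
    finally show "integral {0..T} (\<lambda>t. profile_defect T t * weighted_mean i w t)
      \<le> \<kappa> * integral {0..T} (\<lambda>t. profile T t * weighted_mean i (\<lambda>t x. \<bar>w t x\<bar> powr r) t)
        + B * \<kappa> powr (- 1 / (r - 1)) * T powr ((real CARD('n) + 1) / 2 - r / (r - 1))"
      by (simp add: L_def)
  qed
qed

section \<open>Balancing the exponents and the contradiction\<close>

text \<open>Write M = (m + 1)/2. The first exponent increases in l and asks for l < (p - M (p -
  1))/p, the second decreases and asks for l > M (q - 1) - q. Some l lies between exactly when (M -
  1)(p q - 1) < p + 1, which is the hypothesis since M - 1 = (m - 1)/2.\<close>

lemma exists_balancing_exponent:
  fixes p q m :: real
  assumes "p > 1" "q > 1" "(p + 1) / (p * q - 1) > (m - 1) / 2"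
  obtains l where "l * p / (p - 1) + ((m + 1) / 2 - p / (p - 1)) < 0"
    "- l / (q - 1) + ((m + 1) / 2 - q / (q - 1)) < 0"
proof -
  define M where "M = (m + 1) / 2"
  have pq: "p * q > 1" using assms by (simp add: less_1_mult)
  then have "(M - 1) * (p * q - 1) < p + 1"
    using assms(3) by (simp add: pos_less_divide_eq M_def field_simps)
  then have "p * (M * (q - 1) - q) < p - M * (p - 1)"
    by (simp add: algebra_simps)
  then have "M * (q - 1) - q < (p - M * (p - 1)) / p"
    using assms by (simp add: field_simps)
  then obtain l where l: "M * (q - 1) - q < l" "l < (p - M * (p - 1)) / p"
    using dense by blast
  show ?thesis
  proof
    have "l * p < p - M * (p - 1)" using l(2) assms by (simp add: pos_less_divide_eq)
    then show "l * p / (p - 1) + ((m + 1) / 2 - p / (p - 1)) < 0"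
    proof -
      have "l * p / (p - 1) + (M - p / (p - 1)) = (l * p + M * (p - 1) - p) / (p - 1)"
        using assms by (simp add: add_divide_distrib diff_divide_distrib)
      also have "\<dots> < 0" using \<open>l * p < _\<close> assms by (intro divide_neg_pos) auto
      finally show ?thesis by (simp only: M_def)
    qed
    show "- l / (q - 1) + ((m + 1) / 2 - q / (q - 1)) < 0"
    proof -
      have "- l / (q - 1) + (M - q / (q - 1)) = (M * (q - 1) - q - l) / (q - 1)"
        using assms by (simp add: add_divide_distrib diff_divide_distrib)
      also have "\<dots> < 0" using l(1) assms by (intro divide_neg_pos) auto
      finally show ?thesis by (simp only: M_def)
    qed
  qed
qed

lemma integral_exp_component_pos:
  fixes f :: "real^'n \<Rightarrow> real"
  assumes f: "integrable lborel f" "\<And>x. f x \<ge> 0" "\<And>x. norm x > 1 \<Longrightarrow> f x = 0"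
    "\<not> (AE x in lborel. f x = 0)"
  shows "(LINT x|lborel. f x * exp (x $ i)) > 0"
proof -
  have m: "(\<lambda>x :: real^'n. exp (x $ i)) \<in> borel_measurable borel"
    by (intro borel_measurable_continuous_onI continuous_intros)
  have int: "integrable lborel (\<lambda>x. f x * exp (x $ i))"
  proof (rule Bochner_Integration.integrable_bound)
    show "integrable lborel (\<lambda>x. exp 1 * f x)" using f(1) by simp
    show "(\<lambda>x. f x * exp (x $ i)) \<in> borel_measurable lborel"
      using m borel_measurable_integrable[OF f(1)] by simp
    have "\<bar>f x * exp (x $ i)\<bar> \<le> \<bar>exp 1 * f x\<bar>" for x
    proof (cases "norm x \<le> 1")
      case True
      then have "x $ i \<le> 1" using component_le_norm_cart[of x i] by linarith
      then show ?thesis using mult_left_mono[of "exp (x $ i)" "exp 1" "f x"] f(2)[of x]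
        by (simp add: abs_mult mult.commute)
    qed (use f(3)[of x] in simp)
    then show "AE x in lborel. norm (f x * exp (x $ i)) \<le> norm (exp 1 * f x)" by simp
  qed
  have "(LINT x|lborel. f x * exp (x $ i)) \<noteq> 0"
    using integral_nonneg_eq_0_iff_AE[OF int] f(2,4) by simp
  moreover have "(LINT x|lborel. f x * exp (x $ i)) \<ge> 0"
    using f(2) by (intro Bochner_Integration.integral_nonneg) simp
  ultimately show ?thesis by linarith
qed

text \<open>All data terms carry a favourable sign because \<rho> \<ge> 0 and -\<rho>' \<ge> \<rho>.
  Only the one from f' is kept; the others are discarded, and -\<rho>' in front of |v|^q is lowered
  to \<rho>.\<close>

lemma global_weak_solution_lower_bound:
  fixes p q \<epsilon> :: real and f g f' g' :: "real^'n \<Rightarrow> real" and i :: 'n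
  assumes pq: "p > 1" "q > 1" and \<epsilon>: "\<epsilon> > 0"
    and data: "\<And>x. norm x > 1 \<Longrightarrow> f x = 0 \<and> g x = 0" "\<And>x. norm x > 1 \<Longrightarrow> f' x = 0 \<and> g' x = 0"
    and nonneg: "\<And>x. f x \<ge> 0" "\<And>x. g x \<ge> 0" "\<And>x. f' x \<ge> 0" "\<And>x. g' x \<ge> 0"
    and sol: "global_weak_solution p q \<epsilon> f g f' g' u u1 v v1"
    and supp: "\<And>t. t \<ge> 0 \<Longrightarrow> AE x in lborel. norm x > t + 1 \<longrightarrow> u t x = 0"
      "\<And>t. t \<ge> 0 \<Longrightarrow> AE x in lborel. norm x > t + 1 \<longrightarrow> v t x = 0"
    and T: "T > 0"
  shows "\<epsilon> * exp (- 1) * (LINT x|lborel. f' x * exp (x $ i))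
      + integral {0..T} (\<lambda>t. profile T t * weighted_mean i (\<lambda>t x. \<bar>u1 t x\<bar> powr p) t)
      \<le> integral {0..T} (\<lambda>t. profile_defect T t * weighted_mean i v t)"
    and "integral {0..T} (\<lambda>t. profile T t * weighted_mean i (\<lambda>t x. \<bar>v t x\<bar> powr q) t)
      \<le> integral {0..T} (\<lambda>t. profile_defect T t * weighted_mean i u1 t)"
proof -
  have C: "C_Lr 1 u" "C_Lr 1 v" "C_Lr 1 u1" "C_Lr q v" "C_Lr p u1"
    and td: "is_time_deriv u u1"
    and we: "weak_wave \<epsilon> f g (\<lambda>t x. \<bar>v t x\<bar> powr q) u" "weak_wave \<epsilon> f' g' (\<lambda>t x. \<bar>u1 t x\<bar> powr p) v"
    using sol unfolding global_weak_solution_def by auto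
  have Cp: "C_Lr 1 (\<lambda>t x. \<bar>v t x\<bar> powr q)" "C_Lr 1 (\<lambda>t x. \<bar>u1 t x\<bar> powr p)"
    by (rule C_Lr_powr[OF C(4) pq(2)], rule C_Lr_powr[OF C(5) pq(1)])
  let ?\<rho> = "profile T" and ?F = "weighted_mean i (\<lambda>t x. \<bar>v t x\<bar> powr q)"
    and ?N = "weighted_mean i (\<lambda>t x. \<bar>u1 t x\<bar> powr p)"
  let ?I = "\<lambda>h. LINT x|lborel. (h :: real^'n \<Rightarrow> real) x * exp (x $ i)"
  have I: "?I h \<ge> 0" if "\<And>x. h x \<ge> 0" for h
    using that by (intro Bochner_Integration.integral_nonneg) simp
  note smr = smooth_fun_profile[of T]
  have zr: "?\<rho> t = 0" if "t \<ge> T" for t using profile_eq_0[OF T that] .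
  \<comment> \<open>This value does not depend on T, so the lower bound from the data survives as T
    tends to infinity.\<close>
  have \<rho>0: "?\<rho> 0 = exp (- 1)" by (simp add: profile_def flat_def)
  \<comment> \<open>-\<rho>' exceeds \<rho> by e^{-t} E' / T, and E' is nonnegative.\<close>
  have d\<rho>: "- dderiv 1 ?\<rho> t \<ge> ?\<rho> t" for t
  proof -
    have "flat (flat_step 1) (1 - t / T) \<ge> 0"
      by (simp add: flat_def poly_flat_step)
    then show ?thesis unfolding profile_deriv[OF T] using T
      by (simp add: profile_def mult_left_mono)
  qed
  have \<rho>nn: "?\<rho> t \<ge> 0" for t by (simp add: profile_def flat_one_nonneg)
  have "integral {0..T} (\<lambda>t. profile_defect T t * weighted_mean i v t)
      = integral {0..T} (\<lambda>t. ?\<rho> t * ?N t) + \<epsilon> * (?\<rho> 0 * ?I g') - \<epsilon> * (dderiv 1 ?\<rho> 0 * ?I f')"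
    unfolding profile_defect_eq[OF T, symmetric]
    by (rule weak_wave_weighted_mean[OF we(2) C(2) Cp(2) supp(2) data(2) smr]) (use zr in auto)
  moreover have "\<epsilon> * (?\<rho> 0 * ?I g') \<ge> 0"
    using \<epsilon> \<rho>nn I[OF nonneg(4)] by simp
  moreover have "\<epsilon> * exp (- 1) * ?I f' \<le> \<epsilon> * (- dderiv 1 ?\<rho> 0 * ?I f')"
  proof -
    have "exp (- 1) * ?I f' \<le> - dderiv 1 ?\<rho> 0 * ?I f'"
      using mult_right_mono[OF d\<rho>[of 0] I[of f', OF nonneg(3)]] by (simp only: \<rho>0)
    then have "\<epsilon> * (exp (- 1) * ?I f') \<le> \<epsilon> * (- dderiv 1 ?\<rho> 0 * ?I f')"
      using \<epsilon> by (intro mult_left_mono) auto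
    then show ?thesis by (simp only: mult.assoc)
  qed
  ultimately show "\<epsilon> * exp (- 1) * ?I f' + integral {0..T} (\<lambda>t. ?\<rho> t * ?N t)
      \<le> integral {0..T} (\<lambda>t. profile_defect T t * weighted_mean i v t)"
    by simp
  have cF: "continuous_on {0..} ?F" by (rule continuous_weighted_mean[OF Cp(1)])
  have "integral {0..T} (\<lambda>t. (dderiv 1 (dderiv 1 ?\<rho>) t - ?\<rho> t) * weighted_mean i u1 t)
      = integral {0..T} (\<lambda>t. - dderiv 1 ?\<rho> t * ?F t) + \<epsilon> * (?\<rho> 0 * ?I f) - \<epsilon> * (dderiv 1 ?\<rho> 0 * ?I g)"
  proof (rule wave_time_deriv[OF continuous_weighted_mean[OF C(1)] continuous_weighted_mean[OF C(3)] cF T _ _ smr])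
    fix \<rho> :: "real \<Rightarrow> real" assume \<rho>: "smooth_fun \<rho>" "\<And>t. t \<ge> T \<Longrightarrow> \<rho> t = 0"
    show "integral {0..T} (\<lambda>t. (dderiv 1 (dderiv 1 \<rho>) t - \<rho> t) * weighted_mean i u t)
      = integral {0..T} (\<lambda>t. \<rho> t * ?F t) + \<epsilon> * (\<rho> 0 * ?I g) - \<epsilon> * (dderiv 1 \<rho> 0 * ?I f)"
      by (rule weak_wave_weighted_mean[OF we(1) C(1) Cp(1) supp(1) data(1) \<rho>(1)]) (use \<rho>(2) in auto)
    assume "\<And>t. t \<le> 0 \<Longrightarrow> \<rho> t = 0"
    with \<rho> show "integral {0..T} (\<lambda>t. dderiv 1 \<rho> t * weighted_mean i u t)
        = - integral {0..T} (\<lambda>t. \<rho> t * weighted_mean i u1 t)"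
      by (intro time_deriv_weighted_mean[OF td C(1) C(3) supp(1)]) auto
  qed (use zr in auto)
  moreover have "\<epsilon> * (?\<rho> 0 * ?I f) \<ge> 0"
    using \<epsilon> \<rho>nn I[OF nonneg(1)] by simp
  moreover have "\<epsilon> * (- dderiv 1 ?\<rho> 0 * ?I g) \<ge> 0"
    using \<epsilon> order_trans[OF \<rho>nn d\<rho>] I[OF nonneg(2)] by (intro mult_nonneg_nonneg) auto
  moreover have "integral {0..T} (\<lambda>t. ?\<rho> t * ?F t) \<le> integral {0..T} (\<lambda>t. - dderiv 1 ?\<rho> t * ?F t)"
  proof (rule integral_le)
    have c: "continuous_on {0..T} ?F" by (rule continuous_on_subset[OF cF]) force
    show "(\<lambda>t. ?\<rho> t * ?F t) integrable_on {0..T}" "(\<lambda>t. - dderiv 1 ?\<rho> t * ?F t) integrable_on {0..T}"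
      by (intro integrable_continuous_interval continuous_intros c smooth_fun_continuous
          smooth_fun_real_dderiv smr)+
    show "?\<rho> t * ?F t \<le> - dderiv 1 ?\<rho> t * ?F t" for t
      by (rule mult_right_mono[OF d\<rho> weighted_mean_nonneg]) simp
  qed
  ultimately show "integral {0..T} (\<lambda>t. ?\<rho> t * ?F t)
      \<le> integral {0..T} (\<lambda>t. profile_defect T t * weighted_mean i u1 t)"
    unfolding profile_defect_eq[OF T] by simp
qed

theorem theorem1p4:
  fixes p q \<epsilon> :: real and f g f' g' :: "real^'n \<Rightarrow> real"
  assumes "p > 1" and "q > 1"
    and "(p + 1) / (p * q - 1) > (real CARD('n) - 1) / 2"
    and "(real CARD('n) - 1) / 2 * (q - 1) < 1"
    and "\<epsilon> > 0"
    and "integrable lborel f" "integrable lborel g" "integrable lborel f'" "integrable lborel g'"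
    and "\<forall>x. norm x > 1 \<longrightarrow> f x = 0 \<and> g x = 0 \<and> f' x = 0 \<and> g' x = 0"
    and "\<forall>x. g x - f x \<ge> 0 \<and> f x \<ge> 0 \<and> g' x - f' x \<ge> 0 \<and> f' x \<ge> 0"
    and "\<not> (AE x in lborel. f' x = 0)"
  shows "\<not> (\<exists>u u1 v v1. global_weak_solution p q \<epsilon> f g f' g' u u1 v v1 \<and>
             (\<forall>t\<ge>0. AE x in lborel. norm x > t + 1 \<longrightarrow> u t x = 0 \<and> v t x = 0))"
proof
  assume "\<exists>u u1 v v1. global_weak_solution p q \<epsilon> f g f' g' u u1 v v1 \<and>
             (\<forall>t\<ge>0. AE x in lborel. norm x > t + 1 \<longrightarrow> u t x = 0 \<and> v t x = 0)"
  then obtain u u1 v v1 where sol: "global_weak_solution p q \<epsilon> f g f' g' u u1 v v1"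
    and supp: "\<forall>t\<ge>0. AE x in lborel. norm x > t + 1 \<longrightarrow> u t x = 0 \<and> v t x = 0" by blast
  \<comment> \<open>Any coordinate direction serves; the plane wave needs only one.\<close>
  define i :: 'n where "i = undefined"
  define c0 where "c0 = \<epsilon> * exp (- 1) * (LINT x|lborel. f' x * exp (x $ i))"
  define X where "X T = integral {0..T} (\<lambda>t. profile T t * weighted_mean i (\<lambda>t x. \<bar>u1 t x\<bar> powr p) t)" for T
  define Y where "Y T = integral {0..T} (\<lambda>t. profile T t * weighted_mean i (\<lambda>t x. \<bar>v t x\<bar> powr q) t)" for T
  let ?V = "\<lambda>T. integral {0..T} (\<lambda>t. profile_defect T t * weighted_mean i v t)"
  let ?A = "\<lambda>T. integral {0..T} (\<lambda>t. profile_defect T t * weighted_mean i u1 t)"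
  have nonneg: "f x \<ge> 0" "g x \<ge> 0" "f' x \<ge> 0" "g' x \<ge> 0" for x
  proof -
    have "g x - f x \<ge> 0 \<and> f x \<ge> 0 \<and> g' x - f' x \<ge> 0 \<and> f' x \<ge> 0" using assms(11) ..
    then show "f x \<ge> 0" "g x \<ge> 0" "f' x \<ge> 0" "g' x \<ge> 0" by linarith+
  qed
  have c0: "c0 > 0"
    unfolding c0_def using assms(5,10) integral_exp_component_pos[OF assms(8) nonneg(3) _ assms(12), of i] by simp
  have lower: "c0 + X T \<le> ?V T" "Y T \<le> ?A T" if "T > 0" for T
  proof -
    have "AE x in lborel. norm x > t + 1 \<longrightarrow> u t x = 0" "AE x in lborel. norm x > t + 1 \<longrightarrow> v t x = 0"
      if "t \<ge> 0" for t
      using supp[rule_format, OF that] by (auto elim: eventually_mono)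
    note * = global_weak_solution_lower_bound[OF assms(1,2,5) _ _ nonneg sol this \<open>T > 0\<close>, where i=i]
    show "c0 + X T \<le> ?V T" unfolding c0_def X_def by (rule *(1)) (use assms(10) in auto)
    show "Y T \<le> ?A T" unfolding Y_def by (rule *(2)) (use assms(10) in auto)
  qed
  have C: "C_Lr 1 v" "C_Lr 1 u1" "C_Lr q v" "C_Lr p u1"
    using sol unfolding global_weak_solution_def by auto
  let ?M = "(real CARD('n) + 1) / 2"
  obtain B1 where B1: "B1 > 0" "\<And>T \<kappa>. T \<ge> 2 \<Longrightarrow> \<kappa> > 0 \<Longrightarrow>
      ?V T \<le> \<kappa> * Y T + B1 * \<kappa> powr (- 1 / (q - 1)) * T powr (?M - q / (q - 1))"
    using profile_defect_Young[OF assms(2) C(1,3), where i=i] unfolding Y_def by blast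
  obtain B2 where B2: "B2 > 0" "\<And>T \<kappa>. T \<ge> 2 \<Longrightarrow> \<kappa> > 0 \<Longrightarrow>
      ?A T \<le> \<kappa> * X T + B2 * \<kappa> powr (- 1 / (p - 1)) * T powr (?M - p / (p - 1))"
    using profile_defect_Young[OF assms(1) C(2,4), where i=i] unfolding X_def by blast
  obtain l where l: "l * p / (p - 1) + (?M - p / (p - 1)) < 0" "- l / (q - 1) + (?M - q / (q - 1)) < 0"
    using exists_balancing_exponent[OF assms(1-3)] by blast
  define a where "a = l * p / (p - 1) + (?M - p / (p - 1))"
  define b where "b = - l / (q - 1) + (?M - q / (q - 1))"
  have bound: "c0 \<le> B2 * T powr a + B1 * T powr b" if T: "T \<ge> 2" for T
  proof -
    define \<kappa> where "\<kappa> = T powr l"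
    have \<kappa>: "\<kappa> > 0" using T by (simp add: \<kappa>_def)
    have T0: "T > 0" using T by simp
    have "Y T \<le> 1 / \<kappa> * X T + B2 * (1 / \<kappa>) powr (- 1 / (p - 1)) * T powr (?M - p / (p - 1))"
      using B2(2)[OF T, of "1 / \<kappa>"] lower(2)[OF T0] \<kappa> by simp
    \<comment> \<open>Multiplication by \<kappa> gives X the coefficient 1, so it cancels against
      the X in c0 + X \<le> V.\<close>
    then have "\<kappa> * Y T \<le> \<kappa> * (1 / \<kappa> * X T + B2 * (1 / \<kappa>) powr (- 1 / (p - 1)) * T powr (?M - p / (p - 1)))"
      using \<kappa> by (intro mult_left_mono) auto
    also have "\<dots> = X T + B2 * (\<kappa> * (1 / \<kappa>) powr (- 1 / (p - 1)) * T powr (?M - p / (p - 1)))"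
      using \<kappa> by (simp add: algebra_simps)
    also have "\<kappa> * (1 / \<kappa>) powr (- 1 / (p - 1)) * T powr (?M - p / (p - 1)) = T powr a"
    proof -
      \<comment> \<open>The factor \<kappa> and the Young factor \<kappa>^{1/(p-1)} together give
        T^{l p / (p-1)}, the l-dependent part of the exponent \<open>a\<close>.\<close>
      have "1 / \<kappa> = T powr (- l)" by (simp add: \<kappa>_def powr_minus_divide)
      then have "\<kappa> * (1 / \<kappa>) powr (- 1 / (p - 1)) * T powr (?M - p / (p - 1))
          = T powr (l + (- l) * (- 1 / (p - 1)) + (?M - p / (p - 1)))"
        using T0 by (simp add: \<kappa>_def powr_powr powr_add)
      also have "l + (- l) * (- 1 / (p - 1)) = l * p / (p - 1)"
        using assms(1) by (simp add: field_simps)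
      finally show ?thesis by (simp add: a_def)
    qed
    finally have "\<kappa> * Y T \<le> X T + B2 * T powr a" .
    moreover have "c0 + X T \<le> \<kappa> * Y T + B1 * \<kappa> powr (- 1 / (q - 1)) * T powr (?M - q / (q - 1))"
      using B1(2)[OF T \<kappa>] lower(1)[OF T0] by linarith
    moreover have "\<kappa> powr (- 1 / (q - 1)) * T powr (?M - q / (q - 1)) = T powr b"
      unfolding \<kappa>_def b_def powr_powr powr_add[symmetric] by simp
    ultimately show ?thesis by (simp add: mult.assoc)
  qed
  have "((\<lambda>T. B2 * T powr a + B1 * T powr b) \<longlongrightarrow> B2 * 0 + B1 * 0) at_top"
    using l unfolding a_def b_def
    by (intro tendsto_add tendsto_mult tendsto_const tendsto_neg_powr filterlim_ident)
  moreover have "\<forall>\<^sub>F T in at_top. c0 \<le> B2 * T powr a + B1 * T powr b"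
    using eventually_ge_at_top[of 2] by eventually_elim (rule bound)
  ultimately have "c0 \<le> B2 * 0 + B1 * 0"
    by (rule tendsto_lowerbound) simp
  with c0 show False by simp
qed

end
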